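(* Let $n,k$ be integers with $2\le k\le n-1$, let $\Omega^{n-k}\subset\mathbb{R}^{n-k}$ be a domain, and let $f:\Omega^{n-k}\to[0,\infty)$ be continuously differentiable. Then for every measurable $U\subset\Omega^{n-k}$, the $(n-1)$-volume of the portion of the spherical array $H=\Omega^{n-k}\times_f S^{k-1}$ lying over $U$ is $$\int_U \mathrm{Vol}(S^{k-1}(1))\,[f(x_{k+1},\dots,x_n)]^{k-1}\sqrt{1+f_{x_{k+1}}^2+\cdots+f_{x_n}^2}\;dx_{k+1}\cdots dx_n .$$
   Context: The spherical array $H=\Omega^{n-k}\times_f S^{k-1}$ with base $\Omega^{n-k}$ and warping function $f$ is the hypersurface $$H=\{(x_1,\dots,x_n)\in\mathbb{R}^n:\ (x_{k+1},\dots,x_n)\in\Omega^{n-k},\ x_1^2+\cdots+x_k^2=[f(x_{k+1},\dots,x_n)]^2\}.$$ The portion of $H$ lying over $U$ is the set of points of $H$ with $(x_{k+1},\dots,x_n)\in U$. $f_{x_i}$ denotes the partial derivative of $f$ with respect to $x_i$, and $\mathrm{Vol}(S^{k-1}(1))$ is the $(k-1)$-dimensional volume of the unit sphere in $\mathbb{R}^k$. *)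

theory Defs
  imports "HOL-Analysis.Analysis"
begin

text \<open>
  The \<open>m\<close>-dimensional volume of a subset of a Euclidean space is its \<open>m\<close>-dimensional Hausdorff
  (outer) measure, normalised by the volume of the unit ball of \<open>\<real>\<^sup>m\<close>, so that it is Lebesgue
  measure on \<open>\<real>\<^sup>m\<close> and the usual surface volume on \<open>m\<close>-dimensional submanifolds.  Members of a
  covering must be bounded because \<^const>\<open>diameter\<close> is unspecified on unbounded sets; the
  empty set has to weigh nothing also when \<open>m = 0\<close>.
\<close>

definition hausdorff_weight :: "nat \<Rightarrow> 'a::metric_space set \<Rightarrow> real" where
  "hausdorff_weight m C =
     (if C = {} then 0 else unit_ball_vol (real m) * (diameter C / 2) ^ m)"

definition hausdorff_premeasure :: "real \<Rightarrow> nat \<Rightarrow> 'a::metric_space set \<Rightarrow> ennreal" where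
  "hausdorff_premeasure \<delta> m S =
     (INF C \<in> {C :: nat \<Rightarrow> 'a set.
                 S \<subseteq> (\<Union>i. C i) \<and> (\<forall>i. bounded (C i) \<and> diameter (C i) \<le> \<delta>)}.
        \<Sum>i. ennreal (hausdorff_weight m (C i)))"

definition hausdorff_measure :: "nat \<Rightarrow> 'a::metric_space set \<Rightarrow> ennreal" where
  "hausdorff_measure m S = (SUP \<delta> \<in> {0<..}. hausdorff_premeasure \<delta> m S)"

definition C1_on :: "'a::real_normed_vector set \<Rightarrow> ('a \<Rightarrow> 'b::real_normed_vector) \<Rightarrow> bool" where
  "C1_on S f \<longleftrightarrow>
     (\<exists>f'. (\<forall>x\<in>S. (f has_derivative blinfun_apply (f' x)) (at x)) \<and> continuous_on S f')"

definition partial_deriv :: "'m::finite \<Rightarrow> (real ^ 'm \<Rightarrow> real) \<Rightarrow> real ^ 'm \<Rightarrow> real" where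
  "partial_deriv j f y = deriv (\<lambda>t. f (y + t *\<^sub>R axis j 1)) 0"

text \<open>
  \<open>\<real>\<^sup>n\<close> is \<open>real ^ ('k + 'm)\<close> with \<open>CARD('k) = k\<close> and \<open>CARD('m) = n - k\<close>: the coordinates
  \<open>x\<^sub>1, \<dots>, x\<^sub>k\<close> are those with an index \<open>Inl i\<close>, and \<open>x\<^bsub>k+1\<^esub>, \<dots>, x\<^sub>n\<close> those with an index
  \<open>Inr j\<close>.
\<close>

definition base_point :: "real ^ ('k::finite + 'm::finite) \<Rightarrow> real ^ 'm" where
  "base_point x = (\<chi> j. x $ Inr j)"

definition spherical_array ::
    "(real ^ 'm) set \<Rightarrow> (real ^ 'm \<Rightarrow> real) \<Rightarrow> (real ^ ('k::finite + 'm::finite)) set" where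
  "spherical_array \<Omega> f =
     {x. base_point x \<in> \<Omega> \<and> (\<Sum>i\<in>UNIV. (x $ Inl i)\<^sup>2) = (f (base_point x))\<^sup>2}"

end

theory Submission
  imports Defs
begin

text \<open>
  Write a point of the spherical array as \<open>(v, y)\<close> with \<open>y\<close> in the base and \<open>norm v = f y\<close>.
  Stereographic projection \<open>\<psi>\<close> is a conformal parametrisation of the unit sphere of \<open>\<real>\<^sup>k\<close> minus a
  pole \<open>p\<close> by \<open>\<real>\<^bsup>k-1\<^esup>\<close>, with conformal factor \<open>conf t = 2 / (1 + norm t ^ 2)\<close>, and
  \<open>(t, y) \<mapsto> (f y *\<^sub>R \<psi> t, y)\<close> parametrises the part of the array where \<open>f\<close> is positive, up to
  the points over the pole.  Distances in this chart are given by an exact identity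
  (\<open>dist_warp\<close>) which shows that near \<open>(t, y)\<close> the chart is almost an isometric copy of a linear
  map: a homothety of ratio \<open>f y * conf t\<close> in the direction of \<open>t\<close>, and in the direction
  of \<open>y\<close> the graph map of the differential of \<open>f\<close>, which stretches volume by
  \<open>sqrt (1 + norm (grad f y) ^ 2)\<close>.  The area formula therefore gives the integral of
  \<open>(f y * conf t) ^ (k - 1) * sqrt (1 + norm (grad f y) ^ 2)\<close> for the volume, and by Tonelli the
  integral of \<open>conf t ^ (k - 1)\<close> splits off.  The area formula for \<open>\<psi>\<close> itself identifies that
  factor as the volume of the sphere.  The remaining points, over the pole or with \<open>f y = 0\<close>, all
  have the form \<open>(f y *\<^sub>R p, y)\<close>; they form a locally Lipschitz image of a subset of
  \<open>\<real>\<^bsup>n-k\<^esup>\<close>, of dimension less than \<open>n - 1\<close>, so they carry no volume.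

  Two general facts carry this argument.  The first is that the normalised Hausdorff measure of the
  full dimension is Lebesgue measure (\<open>hausdorff_measure_eq_lborel\<close>).  The normalisation is what
  makes the measures in the dimensions \<open>k - 1\<close> and \<open>n - 1\<close>, which occur on the two sides of
  the formula, comparable.  That the Hausdorff measure is not too large follows from Vitali's covering theorem, which
  fills an open set with small disjoint balls.  That it is not too small is the isodiametric
  inequality: among the sets of a given diameter the ball has the largest volume.  It is the
  inequality of Brunn and Minkowski for a set \<open>A\<close> and its reflection, since \<open>A - A\<close>
  lies in the ball whose radius is the diameter of \<open>A\<close>; the Brunn-Minkowski inequality is proved for
  finite unions of boxes by the cutting argument of Hadwiger and Ohmann.

  The second is the area formula (\<open>area_formula\<close>) for injective maps that are locally as close
  as desired to linear maps in the bi-Lipschitz sense.  Locally it follows from the behaviour of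
  Hausdorff measure under Lipschitz maps; the local pieces are added up by countable
  subadditivity in one direction, and in the other by approximating them from inside by compact sets,
  whose images have positive distances from each other.
\<close>

section \<open>Hausdorff measure as an outer measure\<close>

lemma hausdorff_weight_nonneg: "0 \<le> hausdorff_weight m C" if "bounded C"
  using diameter_ge_0[OF that] by (auto simp: hausdorff_weight_def unit_ball_vol_nonneg)

lemma hausdorff_weight_empty [simp]: "hausdorff_weight m {} = 0"
  by (simp add: hausdorff_weight_def)

lemma hausdorff_weight_mono:
  assumes "C \<subseteq> D" "bounded D"
  shows "hausdorff_weight m C \<le> hausdorff_weight m D"
proof (cases "C = {}")
  case True
  then show ?thesis using hausdorff_weight_nonneg[OF assms(2)] by simp
next
  case False
  then have "D \<noteq> {}" using assms by auto
  have "diameter C \<le> diameter D" "0 \<le> diameter C"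
    using assms diameter_subset diameter_ge_0 bounded_subset by blast+
  then show ?thesis using False \<open>D \<noteq> {}\<close>
    by (auto simp: hausdorff_weight_def unit_ball_vol_nonneg intro!: mult_left_mono power_mono)
qed

lemma hausdorff_premeasure_le:
  assumes "S \<subseteq> (\<Union>i. C i)" "\<And>i. bounded (C i)" "\<And>i. diameter (C i) \<le> \<delta>"
  shows "hausdorff_premeasure \<delta> m S \<le> (\<Sum>i. ennreal (hausdorff_weight m (C i)))"
  unfolding hausdorff_premeasure_def using assms by (intro INF_lower) auto

lemma hausdorff_premeasure_greatest:
  assumes "\<And>C :: nat \<Rightarrow> 'a::metric_space set.
      \<lbrakk>S \<subseteq> (\<Union>i. C i); \<And>i. bounded (C i); \<And>i. diameter (C i) \<le> \<delta>\<rbrakk>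
      \<Longrightarrow> c \<le> (\<Sum>i. ennreal (hausdorff_weight m (C i)))"
  shows "c \<le> hausdorff_premeasure \<delta> m S"
  unfolding hausdorff_premeasure_def using assms by (intro INF_greatest) auto

lemma hausdorff_premeasure_mono:
  assumes "S \<subseteq> T" "\<delta> \<le> \<epsilon>"
  shows "hausdorff_premeasure \<epsilon> m S \<le> hausdorff_premeasure \<delta> m T"
proof (rule hausdorff_premeasure_greatest)
  fix C :: "nat \<Rightarrow> 'a set"
  assume "T \<subseteq> (\<Union>i. C i)" "\<And>i. bounded (C i)" "\<And>i. diameter (C i) \<le> \<delta>"
  then show "hausdorff_premeasure \<epsilon> m S \<le> (\<Sum>i. ennreal (hausdorff_weight m (C i)))"
    using assms by (intro hausdorff_premeasure_le) (auto intro: order_trans)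
qed

lemma hausdorff_premeasure_le_measure:
  "0 < \<delta> \<Longrightarrow> hausdorff_premeasure \<delta> m S \<le> hausdorff_measure m S"
  unfolding hausdorff_measure_def by (intro SUP_upper) auto

lemma hausdorff_measure_least:
  assumes "\<And>\<delta>. 0 < \<delta> \<Longrightarrow> hausdorff_premeasure \<delta> m S \<le> c"
  shows "hausdorff_measure m S \<le> c"
  unfolding hausdorff_measure_def using assms by (intro SUP_least) auto

lemma hausdorff_measure_mono:
  assumes "S \<subseteq> T"
  shows "hausdorff_measure m S \<le> hausdorff_measure m T"
  using hausdorff_premeasure_mono[OF assms order_refl] hausdorff_premeasure_le_measure
  by (intro hausdorff_measure_least) (blast intro: order_trans)

lemma hausdorff_measure_empty [simp]: "hausdorff_measure m {} = 0"
proof -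
  have "hausdorff_premeasure \<delta> m {} \<le> 0" if "0 < \<delta>" for \<delta>
    using hausdorff_premeasure_le[of "{}" "\<lambda>_. {}" \<delta> m] that by simp
  then show ?thesis
    using hausdorff_measure_least[of m "{}" 0] le_zero_eq by metis
qed

lemma hausdorff_measure_singleton:
  assumes "0 < m"
  shows "hausdorff_measure m {x} = 0"
proof -
  have "hausdorff_premeasure \<delta> m {x} \<le> 0" if "0 < \<delta>" for \<delta>
    using hausdorff_premeasure_le[of "{x}" "\<lambda>_. {x}" \<delta> m] that assms
    by (simp add: hausdorff_weight_def zero_power)
  then show ?thesis
    using hausdorff_measure_least[of m "{x}" 0] le_zero_eq by metis
qed

text \<open>
  Covers of the \<open>A i\<close> that are optimal up to \<open>e / 2 ^ Suc i\<close> are merged into one cover,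
  indexed by a bijection between \<open>nat\<close> and \<open>nat \<times> nat\<close>.
\<close>

lemma hausdorff_premeasure_UN_le:
  "hausdorff_premeasure \<delta> m (\<Union>i. A i) \<le> (\<Sum>i. hausdorff_premeasure \<delta> m (A i))"
proof (cases "(\<Sum>i. hausdorff_premeasure \<delta> m (A i)) = \<infinity>")
  case True
  then show ?thesis by simp
next
  case False
  let ?p = "\<lambda>i. hausdorff_premeasure \<delta> m (A i)"
  have fin: "?p i < \<infinity>" for i
    using False ennreal_suminf_lessD less_top by (metis infinity_ennreal_def)
  show ?thesis
  proof (rule ennreal_le_epsilon)
    fix e :: real
    assume "0 < e"
    have "\<exists>C. A i \<subseteq> (\<Union>j. C j) \<and> (\<forall>j. bounded (C j) \<and> diameter (C j) \<le> \<delta>) \<and>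
        (\<Sum>j. ennreal (hausdorff_weight m (C j))) < ?p i + ennreal (e * (1/2)^Suc i)" for i
    proof -
      have "?p i < ?p i + ennreal (e * (1/2)^Suc i)"
        using fin[of i] \<open>0 < e\<close> by (simp add: ennreal_add_left_cancel_less[of _ 0, simplified])
      then show ?thesis
        unfolding hausdorff_premeasure_def[of \<delta> m "A i"]
        by (subst (asm) INF_less_iff) auto
    qed
    then obtain C where C: "\<And>i. A i \<subseteq> (\<Union>j. C i j)" "\<And>i j. bounded (C i j)"
      "\<And>i j. diameter (C i j) \<le> \<delta>"
      "\<And>i. (\<Sum>j. ennreal (hausdorff_weight m (C i j))) < ?p i + ennreal (e * (1/2)^Suc i)"
      by metis
    let ?w = "\<lambda>i j. ennreal (hausdorff_weight m (C i j))"
    have "hausdorff_premeasure \<delta> m (\<Union>i. A i)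
        \<le> (\<Sum>n. ennreal (hausdorff_weight m (case prod_decode n of (i, j) \<Rightarrow> C i j)))"
    proof (rule hausdorff_premeasure_le)
      show "(\<Union>i. A i) \<subseteq> (\<Union>n. case prod_decode n of (i, j) \<Rightarrow> C i j)"
      proof
        fix x assume "x \<in> (\<Union>i. A i)"
        then obtain i j where "x \<in> C i j" using C(1) by blast
        then show "x \<in> (\<Union>n. case prod_decode n of (i, j) \<Rightarrow> C i j)"
          by (intro UN_I[of "prod_encode (i, j)"]) auto
      qed
    qed (use C in \<open>auto split: prod.split\<close>)
    also have "\<dots> = (\<Sum>n. (case prod_decode n of (i, j) \<Rightarrow> ?w i j))"
      by (intro suminf_cong) (auto split: prod.split)
    also have "\<dots> = (\<Sum>i. \<Sum>j. ?w i j)"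
      using suminf_ennreal_2dimen[of "\<lambda>i. \<Sum>j. ?w i j" "\<lambda>(i,j). ?w i j"]
      by (simp add: comp_def)
    also have "\<dots> \<le> (\<Sum>i. ?p i + ennreal (e * (1/2)^Suc i))"
      using C(4) by (intro suminf_le less_imp_le) auto
    also have "\<dots> = (\<Sum>i. ?p i) + (\<Sum>i. ennreal (e * (1/2)^Suc i))"
      by (rule suminf_add[symmetric]) auto
    also have "(\<Sum>i. ennreal (e * (1/2)^Suc i)) = ennreal e"
      using sums_mult[OF power_half_series, of e] \<open>0 < e\<close>
      by (intro suminf_ennreal_eq) auto
    finally show "hausdorff_premeasure \<delta> m (\<Union>i. A i) \<le> (\<Sum>i. ?p i) + ennreal e" .
  qed
qed

lemma hausdorff_measure_UN_le:
  "hausdorff_measure m (\<Union>i. A i) \<le> (\<Sum>i. hausdorff_measure m (A i))"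
proof (rule hausdorff_measure_least)
  fix \<delta> :: real assume "0 < \<delta>"
  have "hausdorff_premeasure \<delta> m (\<Union>i. A i) \<le> (\<Sum>i. hausdorff_premeasure \<delta> m (A i))"
    by (rule hausdorff_premeasure_UN_le)
  also have "\<dots> \<le> (\<Sum>i. hausdorff_measure m (A i))"
    using \<open>0 < \<delta>\<close> by (intro suminf_le hausdorff_premeasure_le_measure) auto
  finally show "hausdorff_premeasure \<delta> m (\<Union>i. A i) \<le> (\<Sum>i. hausdorff_measure m (A i))" .
qed

lemma hausdorff_measure_UN_null:
  assumes "\<And>i. hausdorff_measure m (A i) = 0"
  shows "hausdorff_measure m (\<Union>i::nat. A i) = 0"
  using hausdorff_measure_UN_le[of m A] assms by (simp add: le_zero_eq)

lemma hausdorff_premeasure_Un_le: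
  assumes "0 \<le> \<delta>"
  shows "hausdorff_premeasure \<delta> m (A \<union> B) \<le> hausdorff_premeasure \<delta> m A + hausdorff_premeasure \<delta> m B"
proof -
  let ?A = "\<lambda>i::nat. if i = 0 then A else if i = 1 then B else {}"
  have "hausdorff_premeasure \<delta> m {} = 0"
    using hausdorff_premeasure_le[of "{}" "\<lambda>_. {}" \<delta> m] assms by simp
  then have "(\<Sum>i. hausdorff_premeasure \<delta> m (?A i)) = (\<Sum>i\<in>{0,1}. hausdorff_premeasure \<delta> m (?A i))"
    by (intro suminf_finite) auto
  moreover have "(\<Union>i. ?A i) = A \<union> B" by (auto split: if_splits)
  ultimately show ?thesis
    using hausdorff_premeasure_UN_le[of \<delta> m ?A] by simp
qed

lemma hausdorff_measure_Un_le:
  "hausdorff_measure m (A \<union> B) \<le> hausdorff_measure m A + hausdorff_measure m B"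
proof (rule hausdorff_measure_least)
  fix \<delta> :: real assume "0 < \<delta>"
  then show "hausdorff_premeasure \<delta> m (A \<union> B) \<le> hausdorff_measure m A + hausdorff_measure m B"
    using order_trans[OF hausdorff_premeasure_Un_le[of \<delta> m A B]
        add_mono[OF hausdorff_premeasure_le_measure hausdorff_premeasure_le_measure]] by auto
qed

text \<open>
  A set of diameter at most \<open>\<delta>\<close> cannot meet both \<open>A\<close> and \<open>B\<close>, so the members of a
  cover of \<open>A \<union> B\<close> can be shared out between the two sets without paying for any of them
  twice.
\<close>

lemma hausdorff_premeasure_add_separated:
  assumes "\<And>a b. a \<in> A \<Longrightarrow> b \<in> B \<Longrightarrow> \<delta> < dist a b"
  shows "hausdorff_premeasure \<delta> m A + hausdorff_premeasure \<delta> m B \<le> hausdorff_premeasure \<delta> m (A \<union> B)"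
proof (rule hausdorff_premeasure_greatest)
  fix C :: "nat \<Rightarrow> 'a set"
  assume C: "A \<union> B \<subseteq> (\<Union>i. C i)" "\<And>i. bounded (C i)" "\<And>i. diameter (C i) \<le> \<delta>"
  let ?w = "\<lambda>C. ennreal (hausdorff_weight m C)"
  have sub: "hausdorff_premeasure \<delta> m S \<le> (\<Sum>i. ?w (C i \<inter> S))" if "S \<subseteq> A \<union> B" for S
  proof (rule hausdorff_premeasure_le)
    show "S \<subseteq> (\<Union>i. C i \<inter> S)" using that C(1) by blast
    show "bounded (C i \<inter> S)" for i using C(2) bounded_subset by blast
    show "diameter (C i \<inter> S) \<le> \<delta>" for i
      using diameter_subset[of "C i \<inter> S" "C i"] C(2,3)[of i] by auto
  qed
  have "?w (C i \<inter> A) + ?w (C i \<inter> B) \<le> ?w (C i)" for i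
  proof -
    have "C i \<inter> A = {} \<or> C i \<inter> B = {}"
    proof (rule ccontr)
      assume "\<not> ?thesis"
      then obtain a b where "a \<in> C i" "a \<in> A" "b \<in> C i" "b \<in> B" by blast
      then show False
        using diameter_bounded_bound[OF C(2)[of i], of a b] C(3)[of i] assms[of a b] by linarith
    qed
    moreover have "?w (C i \<inter> A) \<le> ?w (C i)" "?w (C i \<inter> B) \<le> ?w (C i)"
      by (intro ennreal_leI hausdorff_weight_mono C(2) Int_lower1)+
    ultimately show ?thesis by auto
  qed
  then have "(\<Sum>i. ?w (C i \<inter> A)) + (\<Sum>i. ?w (C i \<inter> B)) \<le> (\<Sum>i. ?w (C i))"
    by (subst suminf_add) (auto intro!: suminf_le)
  then show "hausdorff_premeasure \<delta> m A + hausdorff_premeasure \<delta> m B \<le> (\<Sum>i. ?w (C i))"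
    using order_trans[OF add_mono[OF sub[of A] sub[of B]]] by auto
qed

lemma hausdorff_measure_add_separated:
  assumes "0 < d" "\<And>a b. a \<in> A \<Longrightarrow> b \<in> B \<Longrightarrow> d \<le> dist a b"
  shows "hausdorff_measure m A + hausdorff_measure m B \<le> hausdorff_measure m (A \<union> B)"
proof -
  have *: "hausdorff_premeasure \<delta> m A + hausdorff_premeasure \<epsilon> m B \<le> hausdorff_measure m (A \<union> B)"
    if "0 < \<delta>" "0 < \<epsilon>" for \<delta> \<epsilon>
  proof -
    define \<eta> where "\<eta> = min (min \<delta> \<epsilon>) (d / 2)"
    have \<eta>: "0 < \<eta>" "\<eta> \<le> \<delta>" "\<eta> \<le> \<epsilon>" "\<eta> < d"
      using that assms(1) by (auto simp: \<eta>_def)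
    have "hausdorff_premeasure \<delta> m A + hausdorff_premeasure \<epsilon> m B
        \<le> hausdorff_premeasure \<eta> m A + hausdorff_premeasure \<eta> m B"
      using \<eta> by (intro add_mono hausdorff_premeasure_mono) auto
    also have "\<dots> \<le> hausdorff_premeasure \<eta> m (A \<union> B)"
      using \<eta>(4) assms(2) by (intro hausdorff_premeasure_add_separated) force
    also have "\<dots> \<le> hausdorff_measure m (A \<union> B)"
      using \<eta>(1) by (rule hausdorff_premeasure_le_measure)
    finally show ?thesis .
  qed
  have "hausdorff_measure m A + hausdorff_premeasure \<epsilon> m B \<le> hausdorff_measure m (A \<union> B)"
    if "0 < \<epsilon>" for \<epsilon>
    unfolding hausdorff_measure_def[of m A] using * that
    by (subst ennreal_SUP_add_left[symmetric]) (auto intro!: SUP_least)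
  then show ?thesis
    unfolding hausdorff_measure_def[of m B]
    by (subst ennreal_SUP_add_right) (auto intro!: SUP_least)
qed

text \<open>
  Disjoint compact sets have positive distances from each other.  This form of
  additivity is what the lower bound in the area formula rests on.
\<close>

lemma hausdorff_measure_sum_compact_le:
  fixes K :: "'i \<Rightarrow> 'a::heine_borel set"
  assumes "finite I" "\<And>i. i \<in> I \<Longrightarrow> compact (K i)" "disjoint_family_on K I"
  shows "(\<Sum>i\<in>I. hausdorff_measure m (K i)) \<le> hausdorff_measure m (\<Union>i\<in>I. K i)"
  using assms
proof (induction I)
  case empty
  then show ?case by simp
next
  case (insert i I)
  let ?L = "\<Union>j\<in>I. K j"
  have "compact ?L" "compact (K i)" "K i \<inter> ?L = {}"
    using insert by (auto simp: disjoint_family_on_def intro!: compact_UN)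
  then obtain d where "0 < d" "\<And>a b. a \<in> K i \<Longrightarrow> b \<in> ?L \<Longrightarrow> d \<le> dist a b"
    using separate_compact_closed[of "K i" ?L] compact_imp_closed by metis
  then have "hausdorff_measure m (K i) + hausdorff_measure m ?L \<le> hausdorff_measure m (K i \<union> ?L)"
    by (rule hausdorff_measure_add_separated)
  moreover have "(\<Sum>j\<in>I. hausdorff_measure m (K j)) \<le> hausdorff_measure m ?L"
    using insert by (auto simp: disjoint_family_on_def)
  ultimately show ?case
    using insert by (auto intro: order_trans add_left_mono)
qed

lemma ennreal_inverse_mult_cancel:
  assumes "0 < L"
  shows "ennreal (1 / L) * (ennreal L * c) = c" "ennreal L * (ennreal (1 / L) * c) = c"
  using assms by (simp_all add: mult.assoc[symmetric] ennreal_mult[symmetric])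

text \<open>
  A cover of \<open>h ` E\<close> is pulled back to \<open>E\<close> and pushed forward by \<open>g\<close>.  Comparing two
  maps on the same set, instead of speaking of a Lipschitz map from \<open>h ` E\<close> to \<open>g ` E\<close>, makes
  the statement symmetric in \<open>g\<close> and \<open>h\<close> and dispenses with inverse maps.
\<close>

lemma hausdorff_measure_lipschitz:
  fixes g :: "'c \<Rightarrow> 'a::metric_space" and h :: "'c \<Rightarrow> 'b::metric_space"
  assumes "0 < L" and lip: "\<And>x y. x \<in> E \<Longrightarrow> y \<in> E \<Longrightarrow> dist (g x) (g y) \<le> L * dist (h x) (h y)"
  shows "hausdorff_measure m (g ` E) \<le> ennreal (L ^ m) * hausdorff_measure m (h ` E)"
proof (rule hausdorff_measure_least)
  fix \<delta> :: real assume "0 < \<delta>"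
  let ?p = "hausdorff_premeasure \<delta> m (g ` E)"
  have "ennreal (1 / L ^ m) * ?p \<le> hausdorff_premeasure (\<delta> / L) m (h ` E)"
  proof (rule hausdorff_premeasure_greatest)
    fix C :: "nat \<Rightarrow> 'b set"
    assume C: "h ` E \<subseteq> (\<Union>i. C i)" "\<And>i. bounded (C i)" "\<And>i. diameter (C i) \<le> \<delta> / L"
    define D where "D i = g ` (E \<inter> h -` C i)" for i
    have dD: "dist x y \<le> L * diameter (C i)" if xy: "x \<in> D i" "y \<in> D i" for i x y
    proof -
      obtain u v where uv: "u \<in> E" "v \<in> E" "h u \<in> C i" "h v \<in> C i" "x = g u" "y = g v"
        using xy unfolding D_def by blast
      show ?thesis
        using lip[OF uv(1,2)] diameter_bounded_bound[OF C(2) uv(3,4)] uv(5,6) \<open>0 < L\<close>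
        by (smt (verit) mult_left_mono)
    qed
    have bD: "bounded (D i)" for i
      by (rule bounded_subset[OF _ order_refl], unfold bounded_two_points) (use dD in blast)
    have diamD: "diameter (D i) \<le> L * diameter (C i)" if "D i \<noteq> {}" for i
      using dD that by (auto simp: diameter_def[of "D i"] intro!: cSUP_least)
    have dg: "diameter (D i) \<le> \<delta>" for i
    proof (cases "D i = {}")
      case False
      have "L * diameter (C i) \<le> \<delta>"
        using C(3)[of i] \<open>0 < L\<close> by (simp add: field_simps)
      then show ?thesis using diamD[OF False] by simp
    qed (use \<open>0 < \<delta>\<close> in simp)
    have w: "hausdorff_weight m (D i) \<le> L ^ m * hausdorff_weight m (C i)" for i
    proof (cases "D i = {}")
      case False
      then have "C i \<noteq> {}" by (auto simp: D_def)
      have "(diameter (D i) / 2) ^ m \<le> (L * diameter (C i) / 2) ^ m"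
        using diamD[OF False] diameter_ge_0[OF bD] by (intro power_mono) auto
      then have "unit_ball_vol m * (diameter (D i) / 2) ^ m \<le> unit_ball_vol m * (L * diameter (C i) / 2) ^ m"
        by (intro mult_left_mono) auto
      then show ?thesis
        using False \<open>C i \<noteq> {}\<close> by (simp add: hausdorff_weight_def power_mult_distrib power_divide mult_ac)
    qed (use hausdorff_weight_nonneg[OF C(2)] \<open>0 < L\<close> in auto)
    have "?p \<le> (\<Sum>i. ennreal (hausdorff_weight m (D i)))"
    proof (rule hausdorff_premeasure_le)
      show "g ` E \<subseteq> (\<Union>i. D i)" using C(1) by (fastforce simp: D_def)
    qed (use bD dg in auto)
    also have "\<dots> \<le> (\<Sum>i. ennreal (L ^ m) * ennreal (hausdorff_weight m (C i)))"
      using w \<open>0 < L\<close> hausdorff_weight_nonneg[OF C(2)]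
      by (intro suminf_le) (auto simp: ennreal_mult[symmetric] intro!: ennreal_leI)
    also have "\<dots> = ennreal (L ^ m) * (\<Sum>i. ennreal (hausdorff_weight m (C i)))"
      by simp
    finally have "ennreal (1 / L ^ m) * ?p
        \<le> ennreal (1 / L ^ m) * (ennreal (L ^ m) * (\<Sum>i. ennreal (hausdorff_weight m (C i))))"
      by (rule mult_left_mono) simp
    also have "\<dots> = (\<Sum>i. ennreal (hausdorff_weight m (C i)))"
      using \<open>0 < L\<close> by (simp add: mult.assoc[symmetric] ennreal_mult[symmetric])
    finally show "ennreal (1 / L ^ m) * ?p \<le> (\<Sum>i. ennreal (hausdorff_weight m (C i)))" .
  qed
  also have "\<dots> \<le> hausdorff_measure m (h ` E)"
    using \<open>0 < \<delta>\<close> \<open>0 < L\<close> by (intro hausdorff_premeasure_le_measure) simp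
  finally have "ennreal (L ^ m) * (ennreal (1 / L ^ m) * ?p) \<le> ennreal (L ^ m) * hausdorff_measure m (h ` E)"
    by (rule mult_left_mono) simp
  then show "?p \<le> ennreal (L ^ m) * hausdorff_measure m (h ` E)"
    using \<open>0 < L\<close> by (simp add: mult.assoc[symmetric] ennreal_mult[symmetric])
qed

text \<open>
  For \<open>diameter C \<le> \<delta>\<close> the \<open>s\<close>-dimensional weight of \<open>C\<close> is at most a constant times
  \<open>\<delta> ^ (s - m)\<close> times its \<open>m\<close>-dimensional weight.
\<close>

lemma hausdorff_measure_higher_dim_null:
  assumes "hausdorff_measure m S < \<infinity>" "m < s"
  shows "hausdorff_measure s S = 0"
proof -
  let ?\<omega> = "\<lambda>n::nat. unit_ball_vol (real n)"
  define K where "K = ?\<omega> s / ?\<omega> m"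
  have \<omega>: "0 < ?\<omega> n" for n by (simp add: unit_ball_vol_pos)
  obtain c where c: "hausdorff_measure m S = ennreal c" "0 \<le> c"
    using assms(1) by (cases "hausdorff_measure m S") auto
  have K: "0 < K" using \<omega> by (simp add: K_def)
  have *: "hausdorff_premeasure \<delta> s S \<le> ennreal (K * \<delta> ^ (s - m) * c)" if "0 < \<delta>" for \<delta>
  proof -
    let ?L = "K * \<delta> ^ (s - m)"
    have L: "0 < ?L" using that K by simp
    let ?p = "hausdorff_premeasure \<delta> s S"
    have "ennreal (1 / ?L) * ?p \<le> hausdorff_premeasure \<delta> m S"
    proof (rule hausdorff_premeasure_greatest)
      fix C :: "nat \<Rightarrow> 'a set"
      assume C: "S \<subseteq> (\<Union>i. C i)" "\<And>i. bounded (C i)" "\<And>i. diameter (C i) \<le> \<delta>"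
      have w: "hausdorff_weight s (C i) \<le> ?L * hausdorff_weight m (C i)" for i
      proof -
        have d: "0 \<le> diameter (C i)" using diameter_ge_0[OF C(2)] .
        have "(diameter (C i) / 2) ^ s = (diameter (C i) / 2) ^ (s - m) * (diameter (C i) / 2) ^ m"
          using assms(2) by (simp add: power_add[symmetric])
        also have "\<dots> \<le> \<delta> ^ (s - m) * (diameter (C i) / 2) ^ m"
          using d C(3)[of i] by (intro mult_right_mono power_mono) auto
        finally have "?\<omega> s * (diameter (C i) / 2) ^ s \<le> ?\<omega> s * (\<delta> ^ (s - m) * (diameter (C i) / 2) ^ m)"
          by (intro mult_left_mono) auto
        then show ?thesis
          using less_imp_neq[OF \<omega>[of m]] by (auto simp: hausdorff_weight_def K_def)
      qed
      have "?p \<le> (\<Sum>i. ennreal (hausdorff_weight s (C i)))"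
        using C by (intro hausdorff_premeasure_le) auto
      also have "\<dots> \<le> (\<Sum>i. ennreal ?L * ennreal (hausdorff_weight m (C i)))"
        using w L hausdorff_weight_nonneg[OF C(2)]
        by (intro suminf_le) (auto simp: ennreal_mult[symmetric] intro!: ennreal_leI)
      also have "\<dots> = ennreal ?L * (\<Sum>i. ennreal (hausdorff_weight m (C i)))"
        by simp
      finally have "ennreal (1 / ?L) * ?p
        \<le> ennreal (1 / ?L) * (ennreal ?L * (\<Sum>i. ennreal (hausdorff_weight m (C i))))"
        by (rule mult_left_mono) simp
      also have "\<dots> = (\<Sum>i. ennreal (hausdorff_weight m (C i)))"
        using L by (rule ennreal_inverse_mult_cancel)
      finally show "ennreal (1 / ?L) * ?p \<le> (\<Sum>i. ennreal (hausdorff_weight m (C i)))" .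
    qed
    also have "\<dots> \<le> ennreal c"
      using hausdorff_premeasure_le_measure[OF that, of m S] c by simp
    finally have "ennreal ?L * (ennreal (1 / ?L) * ?p) \<le> ennreal ?L * ennreal c"
      by (rule mult_left_mono) simp
    then show ?thesis
      using L c(2) by (simp only: ennreal_inverse_mult_cancel ennreal_mult)
  qed
  have "hausdorff_premeasure \<delta> s S \<le> 0" if "0 < \<delta>" for \<delta>
  proof (rule ennreal_le_epsilon)
    fix e :: real assume "0 < e"
    define \<eta> where "\<eta> = min (min \<delta> 1) (e / (K * (c + 1)))"
    have \<eta>: "0 < \<eta>" "\<eta> \<le> \<delta>" "\<eta> \<le> 1" "\<eta> \<le> e / (K * (c + 1))"
      using that \<open>0 < e\<close> K c by (auto simp: \<eta>_def)
    have "hausdorff_premeasure \<delta> s S \<le> hausdorff_premeasure \<eta> s S"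
      using \<eta> by (intro hausdorff_premeasure_mono) auto
    also have "\<dots> \<le> ennreal (K * \<eta> ^ (s - m) * c)" using \<eta> by (intro *)
    also have "K * \<eta> ^ (s - m) * c \<le> K * \<eta> * (c + 1)"
    proof -
      have "\<eta> ^ (s - m) \<le> \<eta> ^ 1" using \<eta> assms(2) by (intro power_decreasing) auto
      then show ?thesis using K c \<eta> by (intro mult_mono) auto
    qed
    also have "K * \<eta> * (c + 1) \<le> e" using \<eta>(4) K c by (subst (asm) pos_le_divide_eq) (auto simp: mult_ac)
    finally show "hausdorff_premeasure \<delta> s S \<le> 0 + ennreal e" by (simp add: ennreal_leI)
  qed
  then have "hausdorff_measure s S \<le> 0" by (rule hausdorff_measure_least)
  then show ?thesis by simp
qed

section \<open>The Brunn-Minkowski inequality for finite unions of boxes\<close>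

text \<open>
  The nonempty traces on \<open>H\<close> of the members of \<open>F\<close>.  The empty ones are dropped so that cutting
  with a half-space that misses a member lowers the cardinality, which drives the induction in the
  Brunn-Minkowski inequality.
\<close>

definition cut :: "'a set set \<Rightarrow> 'a set \<Rightarrow> 'a set set" where
  "cut F H = (\<lambda>K. K \<inter> H) ` F - {{}}"

definition box_family :: "'a::euclidean_space set set \<Rightarrow> bool" where
  "box_family F \<longleftrightarrow> finite F \<and> disjoint F \<and> (\<forall>K\<in>F. K \<noteq> {} \<and> (\<exists>a b. K = box a b))"

lemma box_familyE:
  assumes "box_family F" "K \<in> F"
  obtains a b where "K = box a b" "box a b \<noteq> {}"
  using assms unfolding box_family_def by metis

lemma sqrt_prod: "sqrt (\<Prod>j\<in>A. f j) = (\<Prod>j\<in>A. sqrt (f j))"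
  by (induction A rule: infinite_finite_induct) (auto simp: real_sqrt_mult)

lemma Union_cut: "\<Union>(cut F H) = \<Union>F \<inter> H"
  by (auto simp: cut_def)

lemma card_cut_le:
  assumes "finite F"
  shows "card (cut F H) \<le> card F"
proof -
  have "card (cut F H) \<le> card ((\<lambda>K. K \<inter> H) ` F)"
    using assms by (auto simp: cut_def intro!: card_mono)
  also have "\<dots> \<le> card F" using assms by (rule card_image_le)
  finally show ?thesis .
qed

lemma card_cut_less:
  assumes "finite F" "K \<in> F" "K \<inter> H = {}"
  shows "card (cut F H) < card F"
proof -
  have "cut F H \<subseteq> (\<lambda>K. K \<inter> H) ` (F - {K})" using assms(3) by (auto simp: cut_def)
  then have "card (cut F H) \<le> card ((\<lambda>K. K \<inter> H) ` (F - {K}))"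
    using assms(1) by (auto intro!: card_mono)
  also have "\<dots> \<le> card (F - {K})" using assms(1) by (intro card_image_le) auto
  also have "\<dots> < card F" using assms by (intro psubset_card_mono) auto
  finally show ?thesis .
qed

lemma box_Int_halfspace_gt:
  fixes a b i :: "'a::euclidean_space"
  assumes "i \<in> Basis"
  shows "box a b \<inter> {x. c < x \<bullet> i} = box (\<Sum>j\<in>Basis. (if j = i then max (a \<bullet> i) c else a \<bullet> j) *\<^sub>R j) b"
  using assms by (auto simp: box_def split: if_splits)

lemma box_Int_halfspace_lt:
  fixes a b i :: "'a::euclidean_space"
  assumes "i \<in> Basis"
  shows "box a b \<inter> {x. x \<bullet> i < c} = box a (\<Sum>j\<in>Basis. (if j = i then min (b \<bullet> i) c else b \<bullet> j) *\<^sub>R j)"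
  using assms by (auto simp: box_def split: if_splits)

lemma box_family_cut:
  assumes "box_family F" and "\<And>a b. \<exists>c d. box a b \<inter> H = box c d"
  shows "box_family (cut F H)"
proof -
  have "disjoint F" using assms(1) by (simp add: box_family_def)
  have "disjoint (cut F H)"
  proof (rule disjointI)
    fix A B assume "A \<in> cut F H" "B \<in> cut F H" "A \<noteq> B"
    then obtain K L where KL: "K \<in> F" "L \<in> F" "A = K \<inter> H" "B = L \<inter> H" "K \<noteq> L"
      by (auto simp: cut_def)
    then have "K \<inter> L = {}" using \<open>disjoint F\<close> by (auto dest: disjointD)
    then show "A \<inter> B = {}" using KL by blast
  qed
  moreover have "\<exists>a b. K = box a b" if K: "K \<in> cut F H" for K
  proof -
    obtain L where L: "L \<in> F" "K = L \<inter> H" using K by (auto simp: cut_def)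
    then obtain a b where "L = box a b" using box_familyE[OF assms(1)] by metis
    then show ?thesis using assms(2)[of a b] L(2) by simp
  qed
  ultimately show ?thesis
    using assms(1) by (auto simp: box_family_def cut_def)
qed

lemma box_family_cut_gt: "box_family F \<Longrightarrow> i \<in> Basis \<Longrightarrow> box_family (cut F {x. c < x \<bullet> i})"
  by (rule box_family_cut) (auto simp: box_Int_halfspace_gt)

lemma box_family_cut_lt: "box_family F \<Longrightarrow> i \<in> Basis \<Longrightarrow> box_family (cut F {x. x \<bullet> i < c})"
  by (rule box_family_cut) (auto simp: box_Int_halfspace_lt)

lemma box_family_open: "box_family F \<Longrightarrow> open (\<Union>F)"
  unfolding box_family_def by (metis open_box open_Union)

lemma box_family_bounded: "box_family F \<Longrightarrow> bounded (\<Union>F)"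
  by (intro bounded_Union) (auto simp: box_family_def bounded_box)

lemma box_family_lmeasurable: "box_family F \<Longrightarrow> \<Union>F \<in> lmeasurable"
  by (intro lmeasurable_open box_family_open box_family_bounded)

text \<open>
  The formula has no case distinction on whether the hyperplane meets the box: the clamped
  coordinate in the product makes the continuity in \<open>c\<close> evident.
\<close>

lemma measure_box_Int_halfspace:
  fixes a b i :: "'a::euclidean_space"
  assumes i: "i \<in> Basis" and ne: "box a b \<noteq> {}"
  shows "measure lebesgue (box a b \<inter> {x. c < x \<bullet> i}) =
    (\<Prod>j\<in>Basis. if j = i then b \<bullet> i - min (b \<bullet> i) (max (a \<bullet> i) c) else (b - a) \<bullet> j)"
proof (cases "c \<le> b \<bullet> i")
  case True
  have ab: "a \<bullet> j < b \<bullet> j" if "j \<in> Basis" for j using ne that by (auto simp: box_ne_empty)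
  show ?thesis
    unfolding box_Int_halfspace_gt[OF i]
    using True ab i
    by (auto simp: measure_lborel_box_eq inner_diff_left less_imp_le intro!: prod.cong)
next
  case False
  then have "box a b \<inter> {x. c < x \<bullet> i} = {}" using i by (force simp: box_def)
  moreover have "(\<Prod>j\<in>Basis. if j = i then b \<bullet> i - min (b \<bullet> i) (max (a \<bullet> i) c) else (b - a) \<bullet> j) = 0"
    using i False by (intro prod_zero) (auto intro!: bexI[of _ i])
  ultimately show ?thesis by simp
qed

lemma continuous_on_measure_cut:
  assumes F: "box_family F" and i: "i \<in> Basis"
  shows "continuous_on UNIV (\<lambda>c. measure lebesgue (\<Union>F \<inter> {x. c < x \<bullet> i}))"
proof -
  have "measure lebesgue (\<Union>F \<inter> {x. c < x \<bullet> i}) = (\<Sum>K\<in>F. measure lebesgue (K \<inter> {x. c < x \<bullet> i}))" for c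
  proof -
    have "measure lebesgue (\<Union>K\<in>F. K \<inter> {x. c < x \<bullet> i}) = (\<Sum>K\<in>F. measure lebesgue (K \<inter> {x. c < x \<bullet> i}))"
    proof (rule measure_finite_Union)
      show "finite F" using F by (simp add: box_family_def)
      have lm: "K \<inter> {x. c < x \<bullet> i} \<in> lmeasurable" if "K \<in> F" for K
        using F that i by (auto simp: box_family_def box_Int_halfspace_gt lmeasurable_box dest!: bspec)
      show "(\<lambda>K. K \<inter> {x. c < x \<bullet> i}) ` F \<subseteq> sets lebesgue" using lm by blast
      show "emeasure lebesgue (K \<inter> {x. c < x \<bullet> i}) \<noteq> \<infinity>" if "K \<in> F" for K
        using lm[OF that] by (auto simp: fmeasurable_def)
      show "disjoint_family_on (\<lambda>K. K \<inter> {x. c < x \<bullet> i}) F"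
        using F unfolding box_family_def disjoint_def disjoint_family_on_def by blast
    qed
    then show ?thesis by simp
  qed
  moreover have "continuous_on UNIV (\<lambda>c. measure lebesgue (K \<inter> {x. c < x \<bullet> i}))" if K: "K \<in> F" for K
  proof -
    obtain a b where ab: "K = box a b" "box a b \<noteq> {}" using box_familyE[OF F K] by metis
    show ?thesis
      unfolding ab(1) measure_box_Int_halfspace[OF i ab(2)]
      apply (rule continuous_on_prod)
      subgoal for j by (cases "j = i") (auto intro!: continuous_intros)
      done
  qed
  ultimately show ?thesis by (simp add: continuous_on_sum)
qed

text \<open>
  By the intermediate value theorem a hyperplane orthogonal to a given axis can be moved until it
  cuts off a prescribed fraction of the volume.
\<close>

lemma measure_cut_interpolate:
  assumes F: "box_family F" and i: "i \<in> Basis" and t: "0 \<le> t" "t \<le> 1"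
  obtains c where "measure lebesgue (\<Union>F \<inter> {x. c < x \<bullet> i}) = t * measure lebesgue (\<Union>F)"
proof -
  obtain B where B: "0 < B" "\<And>x. x \<in> \<Union>F \<Longrightarrow> norm x \<le> B"
    using box_family_bounded[OF F] unfolding bounded_pos by blast
  have Bi: "\<bar>x \<bullet> i\<bar> \<le> B" if "x \<in> \<Union>F" for x
    using B(2)[OF that] Basis_le_norm[OF i, of x] by linarith
  let ?m = "\<lambda>c. measure lebesgue (\<Union>F \<inter> {x. c < x \<bullet> i})"
  have all: "\<Union>F \<inter> {x. - B - 1 < x \<bullet> i} = \<Union>F" using Bi by fastforce
  have none: "\<Union>F \<inter> {x. B < x \<bullet> i} = {}" using Bi by fastforce
  have "\<exists>c\<ge>- B - 1. c \<le> B \<and> ?m c = t * measure lebesgue (\<Union>F)"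
  proof (rule IVT2')
    show "?m B \<le> t * measure lebesgue (\<Union>F)" using none t by simp
    show "t * measure lebesgue (\<Union>F) \<le> ?m (- B - 1)"
      using all t by (simp add: mult_left_le_one_le)
    show "continuous_on {- B - 1..B} ?m"
      using continuous_on_measure_cut[OF F i] continuous_on_subset by blast
  qed (use B in simp)
  then show ?thesis using that by blast
qed

lemma measure_eq_cut_add:
  assumes F: "box_family F" and i: "i \<in> Basis"
  shows "measure lebesgue (\<Union>F) =
    measure lebesgue (\<Union>F \<inter> {x. c < x \<bullet> i}) + measure lebesgue (\<Union>F \<inter> {x. x \<bullet> i < c})"
proof -
  let ?A = "\<Union>F \<inter> {x. c < x \<bullet> i}" and ?B = "\<Union>F \<inter> {x. x \<bullet> i < c}"
  have m: "?A \<in> lmeasurable" "?B \<in> lmeasurable"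
    using box_family_lmeasurable[OF box_family_cut_gt[OF F i]] box_family_lmeasurable[OF box_family_cut_lt[OF F i]]
    by (simp_all add: Union_cut)
  have "measure lebesgue (?A \<union> ?B) = measure lebesgue (\<Union>F)"
  proof (rule measure_negligible_symdiff)
    show "negligible (\<Union> F - (?A \<union> ?B) \<union> (?A \<union> ?B - \<Union> F))"
      by (rule negligible_subset[OF negligible_standard_hyperplane[OF i, of c]]) auto
  qed (rule box_family_lmeasurable[OF F])
  moreover have "measure lebesgue (?A \<union> ?B) = measure lebesgue ?A + measure lebesgue ?B"
    using m by (intro measure_Union) (auto simp: fmeasurable_def)
  ultimately show ?thesis by simp
qed

lemma open_set_plus: "open A \<Longrightarrow> open (A + B)" for A B :: "'a::real_normed_vector set"
proof -
  assume "open A"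
  moreover have "A + B = (\<Union>x\<in>A. \<Union>y\<in>B. {x + y})" by (auto simp: set_plus_def)
  ultimately show ?thesis using open_sums[of A B] by simp
qed

lemma bounded_set_plus: "bounded A \<Longrightarrow> bounded B \<Longrightarrow> bounded (A + B)" for A B :: "'a::real_normed_vector set"
proof -
  assume "bounded A" "bounded B"
  moreover have "A + B = (\<Union>x\<in>A. \<Union>y\<in>B. {x + y})" by (auto simp: set_plus_def)
  ultimately show ?thesis using bounded_sums[of A B] by simp
qed

text \<open>
  Every coordinate of \<open>x\<close> divides the corresponding edge of \<open>box (a + c) (b + d)\<close> in some
  ratio; divide the edges of the two summands in the same ratio.
\<close>

lemma box_subset_set_plus:
  fixes a b c d :: "'a::euclidean_space"
  assumes "box a b \<noteq> {}" "box c d \<noteq> {}"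
  shows "box (a + c) (b + d) \<subseteq> box a b + box c d"
proof
  fix x assume x: "x \<in> box (a + c) (b + d)"
  have ab: "a \<bullet> j < b \<bullet> j" "c \<bullet> j < d \<bullet> j" if "j \<in> Basis" for j
    using assms that by (auto simp: box_ne_empty)
  \<comment> \<open>The ratio in which \<open>x\<close> divides the edge of the large box in direction \<open>j\<close>.\<close>
  define t where "t j = (x \<bullet> j - (a + c) \<bullet> j) / ((b - a) \<bullet> j + (d - c) \<bullet> j)" for j
  have t: "0 < t j" "t j < 1" "x \<bullet> j = (a \<bullet> j + t j * ((b - a) \<bullet> j)) + (c \<bullet> j + t j * ((d - c) \<bullet> j))"
    if "j \<in> Basis" for j
  proof -
    have p: "0 < (b - a) \<bullet> j + (d - c) \<bullet> j" using ab[OF that] by (simp add: inner_diff_left)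
    have q: "(a + c) \<bullet> j < x \<bullet> j" "x \<bullet> j < (b + d) \<bullet> j" using x that by (auto simp: box_def)
    show "0 < t j" "t j < 1" using p q by (auto simp: t_def inner_simps)
    have "t j * ((b - a) \<bullet> j + (d - c) \<bullet> j) = x \<bullet> j - (a + c) \<bullet> j"
      unfolding t_def using p by simp
    then show "x \<bullet> j = (a \<bullet> j + t j * ((b - a) \<bullet> j)) + (c \<bullet> j + t j * ((d - c) \<bullet> j))"
      by (simp add: algebra_simps inner_add_left)
  qed
  define y where "y = (\<Sum>j\<in>Basis. (a \<bullet> j + t j * ((b - a) \<bullet> j)) *\<^sub>R j)"
  have yj: "y \<bullet> j = a \<bullet> j + t j * (b \<bullet> j - a \<bullet> j)" if "j \<in> Basis" for j
    using that by (simp add: y_def inner_diff_left)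
  have mid: "l < l + s * (u - l)" "l + s * (u - l) < u" if "0 < s" "s < 1" "l < u" for l s u :: real
  proof -
    show "l < l + s * (u - l)" using that by simp
    have "s * (u - l) < 1 * (u - l)" using that by (intro mult_strict_right_mono) auto
    then show "l + s * (u - l) < u" by simp
  qed
  have "y \<in> box a b" using mid[OF t(1,2) ab(1)] by (auto simp: box_def yj)
  moreover have "x - y \<in> box c d"
  proof -
    have "(x - y) \<bullet> j = c \<bullet> j + t j * (d \<bullet> j - c \<bullet> j)" if "j \<in> Basis" for j
      using t(3)[OF that] yj[OF that] by (simp add: inner_diff_left)
    then show ?thesis using mid[OF t(1,2) ab(2)] by (auto simp: box_def)
  qed
  ultimately have "y + (x - y) \<in> box a b + box c d" by (rule set_plus_intro)
  then show "x \<in> box a b + box c d" by simp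
qed

text \<open>
  For boxes the inequality is the inequality of arithmetic and geometric means for each pair of
  parallel edges.  The multiplicative form used here, with the geometric mean of the volumes, is
  weaker than the one with \<open>d\<close>-th roots.  It is enough for two sets of equal volume, and it passes
  through the cutting argument without any inequality between powers.
\<close>

lemma brunn_minkowski_box:
  fixes a b c d :: "'a::euclidean_space"
  assumes "box a b \<noteq> {}" "box c d \<noteq> {}"
  shows "2 ^ DIM('a) * sqrt (measure lebesgue (box a b) * measure lebesgue (box c d))
    \<le> measure lebesgue (box a b + box c d)"
proof -
  have ab: "a \<bullet> j < b \<bullet> j" "c \<bullet> j < d \<bullet> j" if "j \<in> Basis" for j
    using assms that by (auto simp: box_ne_empty)
  have "2 ^ DIM('a) * sqrt (measure lebesgue (box a b) * measure lebesgue (box c d))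
      = (\<Prod>j\<in>Basis. 2 * sqrt (((b - a) \<bullet> j) * ((d - c) \<bullet> j)))"
    using ab by (simp add: measure_lborel_box_eq less_imp_le sqrt_prod real_sqrt_mult prod.distrib)
  also have "\<dots> \<le> (\<Prod>j\<in>Basis. ((b + d) - (a + c)) \<bullet> j)"
  proof (rule prod_mono, rule conjI)
    fix j :: 'a assume j: "j \<in> Basis"
    have p: "0 \<le> (b - a) \<bullet> j" "0 \<le> (d - c) \<bullet> j" using ab[OF j] by (auto simp: inner_diff_left)
    show "0 \<le> 2 * sqrt ((b - a) \<bullet> j * ((d - c) \<bullet> j))" using p by simp
    show "2 * sqrt ((b - a) \<bullet> j * ((d - c) \<bullet> j)) \<le> ((b + d) - (a + c)) \<bullet> j"
      using arith_geo_mean_sqrt[OF p] by (simp add: inner_simps)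
  qed
  also have "\<dots> = measure lebesgue (box (a + c) (b + d))"
  proof -
    have "\<forall>j\<in>Basis. (a + c) \<bullet> j \<le> (b + d) \<bullet> j" using ab by (force simp: inner_add_left)
    then show ?thesis by (simp add: measure_lborel_box_eq)
  qed
  also have "\<dots> \<le> measure lebesgue (box a b + box c d)"
    by (intro measure_mono_fmeasurable box_subset_set_plus assms lmeasurable_open bounded_set_plus open_set_plus)
      auto
  finally show ?thesis .
qed

lemma disjoint_boxes_separated:
  fixes a b c d :: "'a::euclidean_space"
  assumes "box a b \<noteq> {}" "box c d \<noteq> {}" "box a b \<inter> box c d = {}"
  obtains i t where "i \<in> Basis" "box a b \<subseteq> {x. x \<bullet> i < t}" "box c d \<subseteq> {x. t < x \<bullet> i}"
    | i t where "i \<in> Basis" "box c d \<subseteq> {x. x \<bullet> i < t}" "box a b \<subseteq> {x. t < x \<bullet> i}"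
proof -
  obtain i where i: "i \<in> Basis" "b \<bullet> i \<le> c \<bullet> i \<or> d \<bullet> i \<le> a \<bullet> i"
    using assms unfolding disjoint_interval(4) box_ne_empty by (metis not_le)
  then show ?thesis
    using that(1)[of i "b \<bullet> i"] that(2)[of i "d \<bullet> i"] by (force simp: box_def)
qed

text \<open>
  The cutting argument of Hadwiger and Ohmann.  A hyperplane between \<open>K\<close> and \<open>L\<close> cuts the union
  of \<open>F\<close> in the ratio \<open>\<theta> : 1 - \<theta>\<close>; a parallel hyperplane cuts the union of \<open>G\<close> in the same
  ratio.  The sum of the two upper parts and the sum of the two lower parts lie on different sides of
  a third parallel hyperplane, so their volumes add up, and since the ratios agree the two lower
  bounds \<open>\<theta> * q\<close> and \<open>(1 - \<theta>) * q\<close> add up as well.  Both upper and lower parts of \<open>F\<close> have fewer boxes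
  than \<open>F\<close>.
\<close>

lemma brunn_minkowski_step:
  fixes F G :: "'a::euclidean_space set set"
  assumes F: "box_family F" and G: "box_family G"
    and K: "K \<in> F" "L \<in> F" and i: "i \<in> Basis"
    and sep: "K \<subseteq> {x. x \<bullet> i < t}" "L \<subseteq> {x. t < x \<bullet> i}"
    and IH: "\<And>F' G' :: 'a set set. \<lbrakk>box_family F'; box_family G'; card F' < card F; card G' \<le> card G\<rbrakk> \<Longrightarrow>
      2 ^ DIM('a) * sqrt (measure lebesgue (\<Union>F') * measure lebesgue (\<Union>G'))
        \<le> measure lebesgue (\<Union>F' + \<Union>G')"
  shows "2 ^ DIM('a) * sqrt (measure lebesgue (\<Union>F) * measure lebesgue (\<Union>G))
        \<le> measure lebesgue (\<Union>F + \<Union>G)"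
proof -
  let ?\<mu> = "measure lebesgue"
  let ?A = "\<Union>F" and ?B = "\<Union>G"
  let ?H = "\<lambda>c. {x. c < x \<bullet> i}" and ?H' = "\<lambda>c. {x. x \<bullet> i < c}"
  have finF: "finite F" and finG: "finite G" using F G by (auto simp: box_family_def)
  define \<theta> where "\<theta> = ?\<mu> (?A \<inter> ?H t) / ?\<mu> ?A"
  have addA: "?\<mu> ?A = ?\<mu> (?A \<inter> ?H t) + ?\<mu> (?A \<inter> ?H' t)" by (rule measure_eq_cut_add[OF F i])
  have posA: "0 < ?\<mu> ?A"
  proof -
    obtain a b where K': "K = box a b" "box a b \<noteq> {}" using box_familyE[OF F K(1)] by metis
    then have "0 < ?\<mu> K"
      by (auto simp: box_ne_empty measure_lborel_box_eq less_imp_le inner_diff_left intro!: prod_pos)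
    also have "?\<mu> K \<le> ?\<mu> ?A"
      using K K' by (intro measure_mono_fmeasurable box_family_lmeasurable F) auto
    finally show ?thesis .
  qed
  have \<theta>: "0 \<le> \<theta>" "\<theta> \<le> 1" using posA addA by (auto simp: \<theta>_def)
  have A1: "?\<mu> (?A \<inter> ?H t) = \<theta> * ?\<mu> ?A" and A2: "?\<mu> (?A \<inter> ?H' t) = (1 - \<theta>) * ?\<mu> ?A"
    using posA addA by (auto simp: \<theta>_def field_simps)
  obtain s where B1: "?\<mu> (?B \<inter> ?H s) = \<theta> * ?\<mu> ?B"
    using measure_cut_interpolate[OF G i \<theta>] by blast
  then have B2: "?\<mu> (?B \<inter> ?H' s) = (1 - \<theta>) * ?\<mu> ?B"
    using measure_eq_cut_add[OF G i, of s] by (simp add: algebra_simps)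
  let ?P = "(?A \<inter> ?H t) + (?B \<inter> ?H s)" and ?N = "(?A \<inter> ?H' t) + (?B \<inter> ?H' s)"
  let ?q = "sqrt (?\<mu> ?A * ?\<mu> ?B)"
  have sq: "sqrt ((r * x) * (r * y)) = r * sqrt (x * y)" if "0 \<le> r" for r x y :: real
  proof -
    have "(r * x) * (r * y) = r\<^sup>2 * (x * y)" by (simp add: power2_eq_square)
    then show ?thesis using that by (simp add: real_sqrt_mult)
  qed
  have card: "card (cut F (?H t)) < card F" "card (cut F (?H' t)) < card F"
    using sep card_cut_less[OF finF K(1), of "?H t"] card_cut_less[OF finF K(2), of "?H' t"] by fastforce+
  have IH1: "2 ^ DIM('a) * sqrt (?\<mu> (\<Union>(cut F (?H t))) * ?\<mu> (\<Union>(cut G (?H s))))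
      \<le> ?\<mu> (\<Union>(cut F (?H t)) + \<Union>(cut G (?H s)))"
    by (rule IH) (intro box_family_cut_gt F G i card card_cut_le finG)+
  have IH2: "2 ^ DIM('a) * sqrt (?\<mu> (\<Union>(cut F (?H' t))) * ?\<mu> (\<Union>(cut G (?H' s))))
      \<le> ?\<mu> (\<Union>(cut F (?H' t)) + \<Union>(cut G (?H' s)))"
    by (rule IH) (intro box_family_cut_lt F G i card card_cut_le finG)+
  have "2 ^ DIM('a) * (\<theta> * ?q) \<le> ?\<mu> ?P"
    using IH1 \<theta> by (simp add: Union_cut A1 B1 sq)
  moreover have "2 ^ DIM('a) * ((1 - \<theta>) * ?q) \<le> ?\<mu> ?N"
    using IH2 \<theta> by (simp add: Union_cut A2 B2 sq)
  ultimately have "2 ^ DIM('a) * ?q \<le> ?\<mu> ?P + ?\<mu> ?N" by (simp add: algebra_simps)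
  also have "\<dots> = ?\<mu> (?P \<union> ?N)"
  proof (rule measure_Union[symmetric])
    have P: "?P \<in> lmeasurable" and N: "?N \<in> lmeasurable"
      using box_family_open[OF box_family_cut_gt[OF F i, of t]] box_family_bounded[OF box_family_cut_gt[OF F i, of t]]
        box_family_bounded[OF box_family_cut_gt[OF G i, of s]]
        box_family_open[OF box_family_cut_lt[OF F i, of t]] box_family_bounded[OF box_family_cut_lt[OF F i, of t]]
        box_family_bounded[OF box_family_cut_lt[OF G i, of s]]
      by (auto simp: Union_cut intro!: lmeasurable_open open_set_plus bounded_set_plus)
    show "?P \<in> sets lebesgue" "?N \<in> sets lebesgue" "emeasure lebesgue ?P \<noteq> \<infinity>" "emeasure lebesgue ?N \<noteq> \<infinity>"
      using P N by (auto simp: fmeasurable_def)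
    have "t + s < x \<bullet> i" if "x \<in> ?P" for x using that by (auto simp: set_plus_def inner_add_left)
    moreover have "x \<bullet> i < t + s" if "x \<in> ?N" for x using that by (auto simp: set_plus_def inner_add_left)
    ultimately show "?P \<inter> ?N = {}" by force
  qed
  also have "\<dots> \<le> ?\<mu> (?A + ?B)"
  proof (rule measure_mono_fmeasurable)
    show "?P \<union> ?N \<subseteq> ?A + ?B" by (auto simp: set_plus_def)
    show "?A + ?B \<in> lmeasurable"
      by (intro lmeasurable_open open_set_plus bounded_set_plus box_family_open box_family_bounded F G)
    have "open ?P" "open ?N"
      using box_family_open[OF box_family_cut_gt[OF F i, of t]] box_family_open[OF box_family_cut_lt[OF F i, of t]]
      by (auto simp: Union_cut intro!: open_set_plus)
    then show "?P \<union> ?N \<in> sets lebesgue" by auto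
  qed
  finally show ?thesis .
qed

lemma brunn_minkowski_box_family:
  fixes F G :: "'a::euclidean_space set set"
  assumes "box_family F" "box_family G"
  shows "2 ^ DIM('a) * sqrt (measure lebesgue (\<Union>F) * measure lebesgue (\<Union>G))
    \<le> measure lebesgue (\<Union>F + \<Union>G)"
  using assms
proof (induction "card F + card G" arbitrary: F G rule: less_induct)
  case less
  have split: "2 ^ DIM('a) * sqrt (measure lebesgue (\<Union>F) * measure lebesgue (\<Union>G))
      \<le> measure lebesgue (\<Union>F + \<Union>G)"
    if F: "box_family F" and G: "box_family G" and KL: "K \<in> F" "L \<in> F" "K \<noteq> L"
      and IH: "\<And>F' G' :: 'a set set. \<lbrakk>box_family F'; box_family G'; card F' < card F; card G' \<le> card G\<rbrakk> \<Longrightarrow>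
      2 ^ DIM('a) * sqrt (measure lebesgue (\<Union>F') * measure lebesgue (\<Union>G'))
        \<le> measure lebesgue (\<Union>F' + \<Union>G')" for F G :: "'a set set" and K L
  proof -
    obtain a b c d where ab: "K = box a b" "L = box c d" "box a b \<noteq> {}" "box c d \<noteq> {}"
      using box_familyE[OF F KL(1)] box_familyE[OF F KL(2)] by metis
    have "K \<inter> L = {}" using F KL by (auto simp: box_family_def disjoint_def)
    then consider i t where "i \<in> Basis" "K \<subseteq> {x. x \<bullet> i < t}" "L \<subseteq> {x. t < x \<bullet> i}"
      | i t where "i \<in> Basis" "L \<subseteq> {x. x \<bullet> i < t}" "K \<subseteq> {x. t < x \<bullet> i}"
      using disjoint_boxes_separated[OF ab(3,4)] unfolding ab(1,2) by metis
    then show ?thesis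
    proof cases
      case 1
      show ?thesis by (rule brunn_minkowski_step[OF F G KL(1,2) 1 IH])
    next
      case 2
      show ?thesis by (rule brunn_minkowski_step[OF F G KL(2,1) 2 IH])
    qed
  qed
  have trich: "F = {} \<or> (\<exists>K. F = {K}) \<or> (\<exists>K L. K \<in> F \<and> L \<in> F \<and> K \<noteq> L)" for F :: "'a set set"
    by (metis is_singletonI' is_singleton_def)
  consider (empty) "F = {} \<or> G = {}" | (F) K L where "K \<in> F" "L \<in> F" "K \<noteq> L"
    | (G) K L where "K \<in> G" "L \<in> G" "K \<noteq> L" | (single) K L where "F = {K}" "G = {L}"
    using trich[of F] trich[of G] by metis
  then show ?case
  proof cases
    case empty
    then show ?thesis by auto
  next
    case F
    show ?thesis
      by (rule split[OF less.prems F]) (rule less.hyps; simp)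
  next
    case G
    have "2 ^ DIM('a) * sqrt (measure lebesgue (\<Union>G) * measure lebesgue (\<Union>F))
      \<le> measure lebesgue (\<Union>G + \<Union>F)"
      by (rule split[OF less.prems(2,1) G]) (rule less.hyps; simp)
    then show ?thesis by (simp add: add.commute mult.commute)
  next
    case single
    obtain a b c d where "K = box a b" "box a b \<noteq> {}" "L = box c d" "box c d \<noteq> {}"
      using box_familyE[OF less.prems(1), of K] box_familyE[OF less.prems(2), of L] single
      by (metis insertI1)
    then show ?thesis
      using single brunn_minkowski_box[of a b c d] by simp
  qed
qed

text \<open>
  If \<open>A\<close> is the union of \<open>F\<close>, then \<open>A - A\<close> has volume at least \<open>2 ^ DIM('a)\<close> times that of \<open>A\<close>
  by the Brunn-Minkowski inequality for \<open>A\<close> and its reflection, and it is contained in the ball of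
  radius \<open>d\<close> around the origin.
\<close>

lemma isodiametric_box_family:
  fixes F :: "'a::euclidean_space set set"
  assumes F: "box_family F" and d: "\<And>x y. x \<in> \<Union>F \<Longrightarrow> y \<in> \<Union>F \<Longrightarrow> dist x y \<le> d" and "0 \<le> d"
  shows "measure lebesgue (\<Union>F) \<le> unit_ball_vol (real DIM('a)) * (d / 2) ^ DIM('a)"
proof -
  let ?G = "(`) uminus ` F"
  have neg_iff: "x \<in> uminus ` S \<longleftrightarrow> - x \<in> S" for x :: 'a and S
    by (metis (no_types) image_iff minus_minus)
  have neg_box: "uminus ` box a b = box (-b) (-a)" for a b :: 'a
    by (rule set_eqI) (auto simp: neg_iff box_def)
  have G: "box_family ?G"
  proof -
    have "disjoint ?G"
    proof (rule disjointI)
      fix A B assume "A \<in> ?G" "B \<in> ?G" "A \<noteq> B"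
      then obtain K L where KL: "K \<in> F" "L \<in> F" "A = uminus ` K" "B = uminus ` L" "K \<noteq> L" by auto
      then have "K \<inter> L = {}" using F by (auto simp: box_family_def disjoint_def)
      then show "A \<inter> B = {}" using KL(3,4) by (auto simp: neg_iff)
    qed
    moreover have "K \<noteq> {} \<and> (\<exists>a b. K = box a b)" if K: "K \<in> ?G" for K
    proof -
      obtain L where L: "L \<in> F" "K = uminus ` L" using K by auto
      obtain a b where "L = box a b" "box a b \<noteq> {}" using box_familyE[OF F L(1)] by metis
      then show ?thesis using neg_box[of a b] L(2) by (metis image_is_empty)
    qed
    ultimately show ?thesis using F by (auto simp: box_family_def)
  qed
  have UG: "\<Union>?G = uminus ` \<Union>F" by blast
  have "measure lebesgue (uminus ` \<Union>F) = measure lebesgue (\<Union>F)"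
    using measure_lebesgue_affine[of "-1" 0 "\<Union>F"] by simp
  then have "2 ^ DIM('a) * measure lebesgue (\<Union>F) \<le> measure lebesgue (\<Union>F + uminus ` \<Union>F)"
    using brunn_minkowski_box_family[OF F G] unfolding UG by simp
  also have "\<dots> \<le> measure lebesgue (cball 0 d :: 'a set)"
  proof (rule measure_mono_fmeasurable)
    show "\<Union>F + uminus ` \<Union>F \<subseteq> cball 0 d"
      using d by (force simp: set_plus_def dist_norm)
    show "\<Union>F + uminus ` \<Union>F \<in> sets lebesgue"
      using open_set_plus[OF box_family_open[OF F]] by simp
  qed simp
  also have "\<dots> = 2 ^ DIM('a) * (unit_ball_vol (real DIM('a)) * (d / 2) ^ DIM('a))"
    using \<open>0 \<le> d\<close> by (simp add: content_cball power_divide)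
  finally show ?thesis by simp
qed

section \<open>The isodiametric inequality\<close>

text \<open>
  An open set is a countable union of closed boxes with disjoint interiors; the interiors of
  finitely many of them form a box family, and these exhaust the volume.
\<close>

lemma isodiametric_open:
  fixes G :: "'a::euclidean_space set"
  assumes "open G" "bounded G" and d: "\<And>x y. x \<in> G \<Longrightarrow> y \<in> G \<Longrightarrow> dist x y \<le> d" and "0 \<le> d"
  shows "measure lebesgue G \<le> unit_ball_vol (real DIM('a)) * (d / 2) ^ DIM('a)"
proof -
  obtain a b where ab: "G \<subseteq> cbox a b" "box a b \<noteq> {}"
  proof -
    obtain c where "G \<subseteq> cbox (- c) c" using bounded_subset_cbox_symmetric[OF assms(2)] by blast
    moreover obtain c' where "cbox (- c) c \<union> cball 0 1 \<subseteq> cbox (- c') c'"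
      using bounded_subset_cbox_symmetric[of "cbox (- c) c \<union> cball 0 1"] by auto
    moreover from this have "box (-c') c' \<noteq> {}"
      using interior_mono[of "cball 0 1" "cbox (-c') c'"] by (auto simp: interior_cbox)
    ultimately show ?thesis using that by blast
  qed
  \<comment> \<open>The gauge keeps the boxes of the covering inside \<open>G\<close>.\<close>
  obtain g where g: "gauge g" "\<And>x. x \<in> G \<Longrightarrow> g x \<subseteq> G"
  proof
    show "gauge (\<lambda>x. if x \<in> G then G else UNIV)" using \<open>open G\<close> by (auto simp: gauge_def)
  qed auto
  obtain \<D> where D: "countable \<D>" "\<And>K. K \<in> \<D> \<Longrightarrow> interior K \<noteq> {} \<and> (\<exists>c d. K = cbox c d)"
    "pairwise (\<lambda>A B. interior A \<inter> interior B = {}) \<D>"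
    "\<And>K. K \<in> \<D> \<Longrightarrow> \<exists>x \<in> G \<inter> K. K \<subseteq> g x" "G \<subseteq> \<Union>\<D>"
    using covering_lemma[OF ab g(1)] by metis
  have DG: "\<Union>\<D> = G" using D(4,5) g(2) by blast
  have lmD: "K \<in> lmeasurable" if "K \<in> \<D>" for K using D(2)[OF that] by auto
  have conv: "convex K" if "K \<in> \<D>" for K using D(2)[OF that] by auto
  have fin: "measure lebesgue (\<Union>D') \<le> unit_ball_vol (real DIM('a)) * (d / 2) ^ DIM('a)"
    if D': "D' \<subseteq> \<D>" "finite D'" for D'
  proof -
    let ?F = "interior ` D'"
    have F: "box_family ?F"
    proof -
      have "disjoint ?F"
      proof (rule disjointI)
        fix A B assume "A \<in> ?F" "B \<in> ?F" "A \<noteq> B"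
        then obtain K L where KL: "K \<in> \<D>" "L \<in> \<D>" "A = interior K" "B = interior L" "K \<noteq> L"
          using D'(1) by auto
        then show "A \<inter> B = {}" using pairwiseD[OF D(3)] by auto
      qed
      moreover have "K \<noteq> {} \<and> (\<exists>a b. K = box a b)" if K: "K \<in> ?F" for K
      proof -
        obtain L where L: "L \<in> \<D>" "K = interior L" using K D'(1) by auto
        then obtain c d where "L = cbox c d" using D(2) by metis
        then show ?thesis using D(2)[OF L(1)] L(2) interior_cbox by metis
      qed
      ultimately show ?thesis using D'(2) by (auto simp: box_family_def)
    qed
    have "\<Union>?F \<subseteq> \<Union>D'" using interior_subset by blast
    have "measure lebesgue (\<Union>D') = measure lebesgue (\<Union>?F)"
    proof (rule measure_negligible_symdiff)
      have "negligible (\<Union>K\<in>D'. frontier K)"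
        using D'(2) D(2) D'(1) by (intro negligible_Union) (auto intro!: negligible_convex_frontier conv)
      moreover have "\<Union>?F - \<Union>D' \<union> (\<Union>D' - \<Union>?F) \<subseteq> (\<Union>K\<in>D'. frontier K)"
      proof
        fix x assume "x \<in> \<Union>?F - \<Union>D' \<union> (\<Union>D' - \<Union>?F)"
        then obtain K where K: "K \<in> D'" "x \<in> K" "x \<notin> interior K"
          using \<open>\<Union>?F \<subseteq> \<Union>D'\<close> by (auto dest: subsetD)
        then have "x \<in> frontier K" using closure_subset by (auto simp: frontier_def)
        then show "x \<in> (\<Union>K\<in>D'. frontier K)" using K(1) by blast
      qed
      ultimately show "negligible (\<Union>?F - \<Union>D' \<union> (\<Union>D' - \<Union>?F))" by (rule negligible_subset)
    qed (rule box_family_lmeasurable[OF F])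
    also have "\<dots> \<le> unit_ball_vol (real DIM('a)) * (d / 2) ^ DIM('a)"
    proof (rule isodiametric_box_family[OF F _ \<open>0 \<le> d\<close>])
      have "\<Union>?F \<subseteq> G" using \<open>\<Union>?F \<subseteq> \<Union>D'\<close> DG D'(1) by blast
      then show "dist x y \<le> d" if "x \<in> \<Union>?F" "y \<in> \<Union>?F" for x y using d that by blast
    qed
    finally show ?thesis .
  qed
  show ?thesis
  proof (rule field_le_epsilon)
    fix e :: real assume "0 < e"
    obtain D' where "D' \<subseteq> \<D>" "finite D'" "measure lebesgue (\<Union>\<D>) - e < measure lebesgue (\<Union>D')"
      using measure_countable_Union_approachable[OF D(1) \<open>0 < e\<close> lmD fin] by blast
    then show "measure lebesgue G \<le> unit_ball_vol (real DIM('a)) * (d / 2) ^ DIM('a) + e"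
      using fin[of D'] DG by simp
  qed
qed

text \<open>
  An arbitrary bounded set is replaced by an open neighbourhood of slightly larger diameter, which
  is measurable and can take its place in a covering.
\<close>

theorem isodiametric:
  fixes C :: "'a::euclidean_space set"
  assumes "bounded C" "0 < e"
  obtains G where "open G" "C \<subseteq> G" "emeasure lborel G \<le> ennreal (hausdorff_weight DIM('a) C + e)"
proof (cases "C = {}")
  case True
  then show ?thesis using that[of "{}"] by simp
next
  case False
  let ?c = "unit_ball_vol (real DIM('a))"
  have "((\<lambda>r. ?c * ((diameter C + 2 * r) / 2) ^ DIM('a)) \<longlongrightarrow> ?c * ((diameter C + 2 * 0) / 2) ^ DIM('a)) (at_right 0)"
    by (intro tendsto_intros) simp
  then have "eventually (\<lambda>r. ?c * ((diameter C + 2 * r) / 2) ^ DIM('a) < hausdorff_weight DIM('a) C + e) (at_right 0)"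
    by (rule order_tendstoD(2)) (use False \<open>0 < e\<close> in \<open>simp add: hausdorff_weight_def\<close>)
  then obtain r where r: "0 < r" "?c * ((diameter C + 2 * r) / 2) ^ DIM('a) < hausdorff_weight DIM('a) C + e"
    using eventually_happens[OF eventually_conj[OF _ eventually_at_right_less[of "0::real"]]] 
    by (metis (no_types, lifting) trivial_limit_at_right_real)
  let ?G = "\<Union>x\<in>C. ball x r"
  have G: "open ?G" "C \<subseteq> ?G" using r(1) by auto
  have d: "dist x y \<le> diameter C + 2 * r" if xy: "x \<in> ?G" "y \<in> ?G" for x y
  proof -
    obtain u v where uv: "u \<in> C" "v \<in> C" "dist u x < r" "dist v y < r" using xy by auto
    have "dist u v \<le> diameter C" using assms(1) uv by (intro diameter_bounded_bound) auto
    then show ?thesis using uv(3,4) dist_triangle[of x y u] dist_triangle[of u y v] by (simp add: dist_commute)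
  qed
  have "bounded ?G"
    unfolding bounded_two_points using d by blast
  then have "measure lebesgue ?G \<le> ?c * ((diameter C + 2 * r) / 2) ^ DIM('a)"
    using G d r(1) diameter_ge_0[OF assms(1)] by (intro isodiametric_open) auto
  then have "emeasure lborel ?G \<le> ennreal (hausdorff_weight DIM('a) C + e)"
    using r(2) lmeasurable_open[OF \<open>bounded ?G\<close> G(1)] G(1)
    by (subst emeasure_eq_ennreal_measure) (auto simp: fmeasurable_def intro!: ennreal_leI)
  then show ?thesis using that G by blast
qed


section \<open>Hausdorff measure of full dimension is Lebesgue measure\<close>

lemma emeasure_lborel_le_hausdorff_measure:
  fixes E :: "'a::euclidean_space set"
  assumes "E \<in> sets borel"
  shows "emeasure lborel E \<le> hausdorff_measure DIM('a) E"
proof -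
  have "emeasure lborel E \<le> hausdorff_premeasure 1 DIM('a) E"
  proof (rule hausdorff_premeasure_greatest)
    fix C :: "nat \<Rightarrow> 'a set"
    assume C: "E \<subseteq> (\<Union>i. C i)" "\<And>i. bounded (C i)" "\<And>i. diameter (C i) \<le> 1"
    let ?w = "\<lambda>i. hausdorff_weight DIM('a) (C i)"
    show "emeasure lborel E \<le> (\<Sum>i. ennreal (?w i))"
    proof (rule ennreal_le_epsilon)
      fix e :: real assume "0 < e"
      have "\<exists>G. open G \<and> C i \<subseteq> G \<and> emeasure lborel G \<le> ennreal (?w i + e * (1/2)^Suc i)" for i
      proof -
        have "0 < e * (1/2)^Suc i" using \<open>0 < e\<close> by simp
        then obtain G where "open G" "C i \<subseteq> G"
          "emeasure lborel G \<le> ennreal (?w i + e * (1/2)^Suc i)"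
          by (rule isodiametric[OF C(2)[of i]])
        then show ?thesis by blast
      qed
      then obtain G where G: "\<And>i. open (G i)" "\<And>i. C i \<subseteq> G i"
        "\<And>i. emeasure lborel (G i) \<le> ennreal (?w i + e * (1/2)^Suc i)"
        by metis
      have "emeasure lborel E \<le> emeasure lborel (\<Union>i. G i)"
        using C(1) G(1,2) by (intro emeasure_mono) (auto intro!: borel_open, blast)
      also have "\<dots> \<le> (\<Sum>i. emeasure lborel (G i))"
        using G(1) by (intro emeasure_subadditive_countably) auto
      also have "\<dots> \<le> (\<Sum>i. ennreal (?w i) + ennreal (e * (1/2)^Suc i))"
        using G(3) hausdorff_weight_nonneg[OF C(2)] \<open>0 < e\<close>
        by (intro suminf_le) (auto simp: ennreal_plus[symmetric] simp del: ennreal_plus)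
      also have "\<dots> = (\<Sum>i. ennreal (?w i)) + (\<Sum>i. ennreal (e * (1/2)^Suc i))"
        by (rule suminf_add[symmetric]) auto
      also have "(\<Sum>i. ennreal (e * (1/2)^Suc i)) = ennreal e"
        using sums_mult[OF power_half_series, of e] \<open>0 < e\<close>
        by (intro suminf_ennreal_eq) auto
      finally show "emeasure lborel E \<le> (\<Sum>i. ennreal (?w i)) + ennreal e" .
    qed
  qed
  then show ?thesis
    using hausdorff_premeasure_le_measure[of 1] by (meson order_trans zero_less_one)
qed

lemma hausdorff_premeasure_le_countable:
  assumes "countable I" "S \<subseteq> (\<Union>i\<in>I. C i)" "0 \<le> \<delta>"
    and "\<And>i. i \<in> I \<Longrightarrow> bounded (C i)" "\<And>i. i \<in> I \<Longrightarrow> diameter (C i) \<le> \<delta>"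
  shows "hausdorff_premeasure \<delta> m S \<le> (\<integral>\<^sup>+ i. ennreal (hausdorff_weight m (C i)) \<partial>count_space I)"
proof -
  let ?J = "to_nat_on I ` I"
  define D where "D n = (if n \<in> ?J then C (from_nat_into I n) else {})" for n
  have Dto: "D (to_nat_on I i) = C i" if "i \<in> I" for i
    using that assms(1) by (simp add: D_def)
  have D: "bounded (D n) \<and> diameter (D n) \<le> \<delta>" for n
    using assms Dto by (cases "n \<in> ?J") (auto simp: D_def)
  have "S \<subseteq> (\<Union>n. D n)" using assms(2) Dto by blast
  then have "hausdorff_premeasure \<delta> m S \<le> (\<Sum>n. ennreal (hausdorff_weight m (D n)))"
    using D by (intro hausdorff_premeasure_le) auto
  also have "\<dots> = (\<integral>\<^sup>+ n. ennreal (hausdorff_weight m (D n)) \<partial>count_space UNIV)"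
    by (rule nn_integral_count_space_nat[symmetric])
  also have "\<dots> = (\<integral>\<^sup>+ n. ennreal (hausdorff_weight m (D n)) \<partial>count_space ?J)"
    by (rule nn_integral_count_space_eq) (auto simp: D_def)
  also have "\<dots> = (\<integral>\<^sup>+ i. ennreal (hausdorff_weight m (D (to_nat_on I i))) \<partial>count_space I)"
    using assms(1) by (intro nn_integral_bij_count_space[symmetric] inj_on_imp_bij_betw inj_on_to_nat_on)
  also have "\<dots> = (\<integral>\<^sup>+ i. ennreal (hausdorff_weight m (C i)) \<partial>count_space I)"
    by (intro nn_integral_cong) (auto simp: Dto)
  finally show ?thesis .
qed

lemma lebesgue_outer_open:
  fixes E :: "'a::euclidean_space set"
  assumes "E \<in> sets lebesgue" "0 < e"
  obtains G where "open G" "E \<subseteq> G" "emeasure lebesgue G \<le> emeasure lebesgue E + ennreal e"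
proof -
  obtain G where G: "open G" "E \<subseteq> G" "G - E \<in> lmeasurable" "emeasure lebesgue (G - E) < ennreal e"
    using sets_lebesgue_outer_open[OF assms] by metis
  have "emeasure lebesgue (E \<union> (G - E)) \<le> emeasure lebesgue E + emeasure lebesgue (G - E)"
    using G(3) assms(1) by (intro emeasure_subadditive) auto
  also have "\<dots> \<le> emeasure lebesgue E + ennreal e" using G(4) by (intro add_left_mono) auto
  also have "E \<union> (G - E) = G" using G(2) by blast
  finally show ?thesis using that G by blast
qed

text \<open>
  The half of the upper bound that Vitali's theorem leaves open: it exhausts a set only up to a
  negligible one.  A negligible set is covered by small cubes of small total volume, and for cubes
  the weight \<open>hausdorff_weight\<close> is a constant multiple \<open>\<kappa>\<close> of the volume.
\<close>

lemma hausdorff_measure_negligible_bounded: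
  fixes N :: "'a::euclidean_space set"
  assumes "negligible N" "bounded N"
  shows "hausdorff_measure DIM('a) N = 0"
proof -
  define \<kappa> where "\<kappa> = unit_ball_vol (real DIM('a)) * (sqrt DIM('a) / 2) ^ DIM('a)"
  have \<kappa>: "0 \<le> \<kappa>" by (simp add: \<kappa>_def)
  have cube: "hausdorff_weight DIM('a) (cbox u v) = \<kappa> * s ^ DIM('a)"
    if s: "0 \<le> s" "\<And>i. i \<in> Basis \<Longrightarrow> v \<bullet> i - u \<bullet> i = s" for u v :: 'a and s
  proof -
    have "v - u = s *\<^sub>R One" by (rule euclidean_eqI) (auto simp: inner_diff_left s)
    have le: "u \<bullet> i \<le> v \<bullet> i" if "i \<in> Basis" for i using s(1) s(2)[OF that] by simp
    have "x \<bullet> One = 1" if "x \<in> Basis" for x :: 'a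
      using that by (simp add: inner_sum_right inner_Basis)
    then have "norm (One :: 'a) = sqrt DIM('a)"
      by (simp add: norm_eq_sqrt_inner inner_sum_left)
    then have "norm (v - u) = s * sqrt DIM('a)"
      unfolding \<open>v - u = _\<close> norm_scaleR using s(1) by simp
    then have "dist u v = sqrt DIM('a) * s"
      by (metis dist_commute dist_norm mult.commute)
    then have "diameter (cbox u v) = sqrt DIM('a) * s"
      using le by (simp add: diameter_cbox)
    moreover have "cbox u v \<noteq> {}" using le by (simp add: box_ne_empty)
    ultimately show ?thesis
      by (simp add: hausdorff_weight_def \<kappa>_def power_mult_distrib power_divide)
  qed
  obtain M where M: "0 < M" "N \<subseteq> cbox (- (M *\<^sub>R One)) (M *\<^sub>R One)"
  proof -
    obtain B where B: "0 < B" "\<And>x. x \<in> N \<Longrightarrow> norm x \<le> B" using assms(2) bounded_pos by metis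
    have "N \<subseteq> cbox (- (B *\<^sub>R One)) (B *\<^sub>R One)"
    proof
      fix x assume "x \<in> N"
      then have "- B \<le> x \<bullet> i \<and> x \<bullet> i \<le> B" if "i \<in> Basis" for i
        using B(2)[of x] Basis_le_norm[OF that, of x] by linarith
      then show "x \<in> cbox (- (B *\<^sub>R One)) (B *\<^sub>R One)"
        by (simp add: mem_box)
    qed
    then show ?thesis using that B(1) by blast
  qed
  have "hausdorff_premeasure \<delta> DIM('a) N \<le> 0" if "0 < \<delta>" for \<delta>
  proof (rule ennreal_le_epsilon)
    fix e :: real assume "0 < e"
    have "N \<in> null_sets lebesgue" using assms(1) by (simp add: negligible_iff_null_sets)
    then have N: "N \<in> sets lebesgue" "emeasure lebesgue N = 0" by auto
    have "0 < e / (\<kappa> + 1)" using \<open>0 < e\<close> \<kappa> by simp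
    with N(1) obtain G where G: "open G" "N \<subseteq> G"
      and "emeasure lebesgue G \<le> emeasure lebesgue N + ennreal (e / (\<kappa> + 1))"
      by (rule lebesgue_outer_open)
    then have G': "emeasure lebesgue G \<le> ennreal (e / (\<kappa> + 1))" using N(2) by simp
    \<comment> \<open>The gauge keeps the cubes inside \<open>G\<close>, so that their volumes add up to at most that of \<open>G\<close>, and
      it makes their diameters at most \<open>\<delta>\<close>.\<close>
    define g where "g x = (if x \<in> G then G \<inter> ball x (\<delta> / 2) else UNIV)" for x
    have "gauge g" using G(1) \<open>0 < \<delta>\<close> by (auto simp: gauge_def g_def)
    have ne: "box (- (M *\<^sub>R One)) (M *\<^sub>R One :: 'a) \<noteq> {}" using M(1) by (simp add: box_ne_empty)
    obtain \<D> where D: "countable \<D>" "\<And>K. K \<in> \<D> \<Longrightarrow> interior K \<noteq> {} \<and> (\<exists>c d. K = cbox c d)"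
      "pairwise (\<lambda>A B. interior A \<inter> interior B = {}) \<D>"
      "\<And>K. K \<in> \<D> \<Longrightarrow> \<exists>x \<in> N \<inter> K. K \<subseteq> g x"
      "\<And>u v. cbox u v \<in> \<D> \<Longrightarrow> \<exists>n. \<forall>i \<in> Basis. v \<bullet> i - u \<bullet> i = ((M *\<^sub>R One) \<bullet> i - (- (M *\<^sub>R One)) \<bullet> i) / 2^n"
      "N \<subseteq> \<Union>\<D>"
      using covering_lemma[OF M(2) ne \<open>gauge g\<close>] by metis
    have KG: "K \<subseteq> G" "bounded K" "diameter K \<le> \<delta>" if K: "K \<in> \<D>" for K
    proof -
      obtain x where x: "x \<in> N" "K \<subseteq> G \<inter> ball x (\<delta> / 2)"
        using D(4)[OF K] G(2) by (auto simp: g_def subset_iff)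
      then show "K \<subseteq> G" "bounded K" using bounded_subset[OF bounded_ball] by blast+
      show "diameter K \<le> \<delta>"
        using diameter_subset[of K "ball x (\<delta> / 2)"] x(2) \<open>0 < \<delta>\<close> by auto
    qed
    have wK: "ennreal (hausdorff_weight DIM('a) K) = ennreal \<kappa> * emeasure lborel (interior K)"
      if K: "K \<in> \<D>" for K
    proof -
      obtain u v where uv: "K = cbox u v" using D(2)[OF K] by blast
      then obtain n where n: "\<forall>i \<in> Basis. v \<bullet> i - u \<bullet> i = ((M *\<^sub>R One) \<bullet> i - (- (M *\<^sub>R One)) \<bullet> i) / 2^n"
        using D(5) K by blast
      define s where "s = 2 * M / 2 ^ n"
      have s: "0 \<le> s" "v \<bullet> i - u \<bullet> i = s" if "i \<in> Basis" for i
        using M(1) n that by (auto simp: s_def)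
      have "0 \<le> s" using M(1) by (simp add: s_def)
      have le: "u \<bullet> i \<le> v \<bullet> i" if "i \<in> Basis" for i using s[OF that] by simp
      have "emeasure lborel (interior K) = ennreal (s ^ DIM('a))"
        using le s(2) \<open>0 \<le> s\<close>
        by (simp add: uv interior_cbox emeasure_lborel_box_eq inner_diff_left)
      then show ?thesis
        using cube[OF \<open>0 \<le> s\<close> s(2)] \<kappa> \<open>0 \<le> s\<close> by (simp add: uv ennreal_mult)
    qed
    have "hausdorff_premeasure \<delta> DIM('a) N \<le> (\<integral>\<^sup>+ K. ennreal (hausdorff_weight DIM('a) K) \<partial>count_space \<D>)"
      using D(1,6) \<open>0 < \<delta>\<close> KG by (intro hausdorff_premeasure_le_countable) auto
    also have "\<dots> = (\<integral>\<^sup>+ K. ennreal \<kappa> * emeasure lborel (interior K) \<partial>count_space \<D>)"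
      by (intro nn_integral_cong) (simp add: wK)
    also have "\<dots> = ennreal \<kappa> * (\<integral>\<^sup>+ K. emeasure lborel (interior K) \<partial>count_space \<D>)"
      by (intro nn_integral_cmult) simp
    also have "(\<integral>\<^sup>+ K. emeasure lborel (interior K) \<partial>count_space \<D>) = emeasure lborel (\<Union>K\<in>\<D>. interior K)"
      using D(1,3) by (intro emeasure_UN_countable[symmetric]) (auto simp: disjoint_family_on_def pairwise_def)
    also have "\<dots> \<le> emeasure lborel G"
      using KG(1) interior_subset G(1) by (intro emeasure_mono) (auto dest: subsetD)
    also have "emeasure lborel G \<le> ennreal (e / (\<kappa> + 1))" using G(1) G' by simp
    also have "ennreal \<kappa> * ennreal (e / (\<kappa> + 1)) \<le> ennreal e"
    proof -
      have "\<kappa> * (e / (\<kappa> + 1)) \<le> e" using \<kappa> \<open>0 < e\<close> by (simp add: field_simps)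
      then show ?thesis using \<kappa> \<open>0 < e\<close> by (simp add: ennreal_mult[symmetric] ennreal_leI)
    qed
    finally show "hausdorff_premeasure \<delta> DIM('a) N \<le> 0 + ennreal e" by (simp add: mult_left_mono)
  qed
  then have "hausdorff_measure DIM('a) N \<le> 0" by (rule hausdorff_measure_least)
  then show ?thesis by simp
qed

lemma hausdorff_measure_negligible:
  fixes N :: "'a::euclidean_space set"
  assumes "negligible N"
  shows "hausdorff_measure DIM('a) N = 0"
proof -
  have "N = (\<Union>i::nat. N \<inter> ball 0 (real i))" using reals_Archimedean2 by auto
  moreover have "hausdorff_measure DIM('a) (N \<inter> ball 0 (real i)) = 0" for i
    using assms by (intro hausdorff_measure_negligible_bounded negligible_Int) (auto simp: bounded_Int)
  ultimately show ?thesis using hausdorff_measure_UN_null by metis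
qed

text \<open>
  For a ball the weight \<open>hausdorff_weight\<close> is exactly its volume, and by Vitali's theorem disjoint
  balls of diameter at most \<open>\<delta>\<close> fill \<open>G\<close> up to a negligible set.
\<close>

lemma hausdorff_measure_open_le:
  fixes G :: "'a::euclidean_space set"
  assumes "open G"
  shows "hausdorff_measure DIM('a) G \<le> emeasure lborel G"
proof (rule hausdorff_measure_least)
  fix \<delta> :: real assume "0 < \<delta>"
  define K where "K = {(x, r). 0 < r \<and> r \<le> \<delta> / 2 \<and> ball x r \<subseteq> G}"
  let ?b = "\<lambda>i. ball (fst i) (snd i) :: 'a set"
  have vitali: "\<exists>i. i \<in> K \<and> x \<in> ?b i \<and> snd i < d" if "x \<in> G" "0 < d" for x d
  proof -
    obtain s where s: "0 < s" "ball x s \<subseteq> G" using assms \<open>x \<in> G\<close> open_contains_ball by metis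
    define r where "r = min (min s (d / 2)) (\<delta> / 2)"
    have r: "0 < r" "r \<le> s" "r < d" "r \<le> \<delta> / 2" using s \<open>0 < d\<close> \<open>0 < \<delta>\<close> by (auto simp: r_def)
    then have "(x, r) \<in> K" using s subset_ball[OF r(2), of x] by (auto simp: K_def)
    then show ?thesis using r by (intro exI[of _ "(x, r)"]) auto
  qed
  obtain C where C: "countable C" "C \<subseteq> K" "pairwise (\<lambda>i j. disjnt (?b i) (?b j)) C"
    "negligible (G - (\<Union>i\<in>C. ?b i))"
    by (rule Vitali_covering_theorem_balls[where a = fst and r = snd, OF vitali])
  have CK: "0 < snd i" "2 * snd i \<le> \<delta>" "?b i \<subseteq> G" if "i \<in> C" for i
    using subsetD[OF C(2) that] by (simp_all add: K_def case_prod_beta mult.commute)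
  let ?U = "\<Union>i\<in>C. ?b i"
  have "hausdorff_premeasure \<delta> DIM('a) ?U \<le> (\<integral>\<^sup>+ i. ennreal (hausdorff_weight DIM('a) (?b i)) \<partial>count_space C)"
    using C(1) \<open>0 < \<delta>\<close> CK by (intro hausdorff_premeasure_le_countable) (auto simp: less_imp_le)
  also have "\<dots> = (\<integral>\<^sup>+ i. emeasure lborel (?b i) \<partial>count_space C)"
    using CK by (intro nn_integral_cong) (auto simp: hausdorff_weight_def emeasure_ball less_imp_le not_le[symmetric])
  also have "\<dots> = emeasure lborel ?U"
    using C(1,3) by (intro emeasure_UN_countable[symmetric]) (auto simp: disjoint_family_on_def pairwise_def disjnt_def)
  also have "\<dots> \<le> emeasure lborel G"
    using CK(3) assms by (intro emeasure_mono) auto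
  finally have U: "hausdorff_premeasure \<delta> DIM('a) ?U \<le> emeasure lborel G" .
  have "hausdorff_premeasure \<delta> DIM('a) (G - ?U) \<le> 0"
    using hausdorff_premeasure_le_measure[OF \<open>0 < \<delta>\<close>] hausdorff_measure_negligible[OF C(4)] by metis
  then have "hausdorff_premeasure \<delta> DIM('a) (?U \<union> (G - ?U)) \<le> emeasure lborel G"
    using hausdorff_premeasure_Un_le[of \<delta> "DIM('a)" ?U "G - ?U"] U \<open>0 < \<delta>\<close> by auto
  then show "hausdorff_premeasure \<delta> DIM('a) G \<le> emeasure lborel G"
    by (rule order_trans[OF hausdorff_premeasure_mono, rotated -1]) auto
qed

theorem hausdorff_measure_eq_lborel:
  fixes E :: "'a::euclidean_space set"
  assumes "E \<in> sets borel"
  shows "hausdorff_measure DIM('a) E = emeasure lborel E"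
proof (rule antisym)
  show "hausdorff_measure DIM('a) E \<le> emeasure lborel E"
  proof (rule ennreal_le_epsilon)
    fix e :: real assume "0 < e"
    obtain G where G: "open G" "E \<subseteq> G" "emeasure lebesgue G \<le> emeasure lebesgue E + ennreal e"
      using lebesgue_outer_open[of E e] assms \<open>0 < e\<close> by auto
    have "hausdorff_measure DIM('a) E \<le> hausdorff_measure DIM('a) G"
      using G(2) by (rule hausdorff_measure_mono)
    also have "\<dots> \<le> emeasure lborel G" using G(1) by (rule hausdorff_measure_open_le)
    also have "\<dots> \<le> emeasure lborel E + ennreal e" using G(1,3) assms by simp
    finally show "hausdorff_measure DIM('a) E \<le> emeasure lborel E + ennreal e" .
  qed
qed (rule emeasure_lborel_le_hausdorff_measure[OF assms])

section \<open>The area formula\<close>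

text \<open>
  For a linear bijection, \<open>c\<close> is the modulus of its determinant.  Defining the factor by
  its effect on volumes makes it available in every Euclidean space, in particular in products.
\<close>

definition scales_volume :: "('a::euclidean_space \<Rightarrow> 'a) \<Rightarrow> real \<Rightarrow> bool" where
  "scales_volume T c \<longleftrightarrow> linear T \<and>
     (\<forall>E\<in>sets borel. T ` E \<in> sets borel \<and> emeasure lborel (T ` E) = ennreal c * emeasure lborel E)"

lemma hausdorff_measure_image_bilipschitz:
  fixes \<phi> :: "'a::euclidean_space \<Rightarrow> 'b::metric_space"
  assumes T: "scales_volume T c" and E: "E \<in> sets borel" and "0 < \<tau>"
    and bilip: "\<And>u v. u \<in> E \<Longrightarrow> v \<in> E \<Longrightarrow>
      dist (\<phi> u) (\<phi> v) \<le> \<tau> * dist (T u) (T v) \<and> dist (T u) (T v) \<le> \<tau> * dist (\<phi> u) (\<phi> v)"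
  shows "hausdorff_measure DIM('a) (\<phi> ` E) \<le> ennreal (\<tau> ^ DIM('a)) * (ennreal c * emeasure lborel E)"
    and "ennreal c * emeasure lborel E \<le> ennreal (\<tau> ^ DIM('a)) * hausdorff_measure DIM('a) (\<phi> ` E)"
proof -
  have "hausdorff_measure DIM('a) (T ` E) = ennreal c * emeasure lborel E"
    using T E hausdorff_measure_eq_lborel[of "T ` E"] by (simp add: scales_volume_def)
  then show "hausdorff_measure DIM('a) (\<phi> ` E) \<le> ennreal (\<tau> ^ DIM('a)) * (ennreal c * emeasure lborel E)"
    and "ennreal c * emeasure lborel E \<le> ennreal (\<tau> ^ DIM('a)) * hausdorff_measure DIM('a) (\<phi> ` E)"
    using hausdorff_measure_lipschitz[of \<tau> E \<phi> T "DIM('a)"] hausdorff_measure_lipschitz[of \<tau> E T \<phi> "DIM('a)"]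
      bilip \<open>0 < \<tau>\<close> by simp_all
qed

lemma ennreal_le_of_le_power_mult:
  fixes a b :: ennreal
  assumes "\<And>\<tau>. 1 < \<tau> \<Longrightarrow> a \<le> ennreal (\<tau> ^ n) * b"
  shows "a \<le> b"
proof (cases b)
  case (real r)
  have "((\<lambda>\<tau>. ennreal (\<tau> ^ n * r)) \<longlongrightarrow> ennreal (1 ^ n * r)) (at_right 1)"
    by (intro tendsto_intros)
  moreover have "eventually (\<lambda>\<tau>. a \<le> ennreal (\<tau> ^ n * r)) (at_right 1)"
    using eventually_at_right_less[of "1::real"]
  proof eventually_elim
    case (elim \<tau>)
    then show ?case using assms[OF elim] real by (simp add: ennreal_mult)
  qed
  ultimately have "a \<le> ennreal (1 ^ n * r)"
    by (rule tendsto_lowerbound) simp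
  then show ?thesis using real by simp
qed simp

lemma continuous_ratio_close:
  fixes h :: "'a::metric_space \<Rightarrow> real"
  assumes "isCont h x" "0 < h x" "1 < \<tau>"
  obtains r where "0 < r" "\<And>y. y \<in> ball x r \<Longrightarrow> h y \<le> \<tau> * h x \<and> h x \<le> \<tau> * h y"
proof -
  have "h x < \<tau> * h x" "h x / \<tau> < h x"
    using assms(2,3) by (auto simp: field_simps)
  then have "eventually (\<lambda>y. h y < \<tau> * h x \<and> h x / \<tau> < h y) (nhds x)"
    using assms(1) unfolding continuous_at by (intro eventually_conj order_tendstoD) (auto simp: tendsto_at_iff_tendsto_nhds)
  then obtain r where r: "0 < r" "\<And>y. dist y x < r \<Longrightarrow> h y < \<tau> * h x \<and> h x / \<tau> < h y"
    unfolding eventually_nhds_metric by blast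
  have "h y \<le> \<tau> * h x \<and> h x \<le> \<tau> * h y" if "y \<in> ball x r" for y
    using r(2)[of y] that assms(3) by (auto simp: dist_commute field_simps)
  then show ?thesis using that r(1) by blast
qed

text \<open>
  The regularity of \<open>\<phi>\<close> is expressed by distances: near every point \<open>x\<close> and for every
  \<open>\<tau> > 1\<close>, the distances of images under \<open>\<phi>\<close> agree up to the factor \<open>\<tau>\<close> with those under a
  linear map whose volume factor is \<open>J x\<close>; for an immersion of class \<open>C\<^sup>1\<close> this is the square
  root of the Gram determinant of its differential.  On a small ball \<open>\<phi>\<close> then changes volumes
  like that linear map up to the factor \<open>\<tau> ^ DIM('a)\<close>, and \<open>J\<close> varies by a further factor of at
  most \<open>\<tau>\<close>.  Summing over countably many such balls gives the formula up to the factor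
  \<open>\<tau> ^ Suc DIM('a)\<close>, and \<open>\<tau>\<close> tends to 1.
\<close>

theorem area_formula:
  fixes \<phi> :: "'a::euclidean_space \<Rightarrow> 'b::heine_borel" and J :: "'a \<Rightarrow> real"
  assumes W: "open W" and inj: "inj_on \<phi> W"
    and J: "continuous_on W J" "\<And>x. x \<in> W \<Longrightarrow> 0 < J x"
    and loc: "\<And>x \<tau>. x \<in> W \<Longrightarrow> 1 < \<tau> \<Longrightarrow> \<exists>T r. 0 < r \<and> scales_volume T (J x) \<and>
      (\<forall>u\<in>ball x r. \<forall>v\<in>ball x r.
        dist (\<phi> u) (\<phi> v) \<le> \<tau> * dist (T u) (T v) \<and> dist (T u) (T v) \<le> \<tau> * dist (\<phi> u) (\<phi> v))"
    and E: "E \<in> sets borel" "E \<subseteq> W"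
  shows "hausdorff_measure DIM('a) (\<phi> ` E) = (\<integral>\<^sup>+ x\<in>E. ennreal (J x) \<partial>lborel)"
proof (cases "W = {}")
  case True
  then show ?thesis using E by simp
next
  case False
  let ?H = "hausdorff_measure DIM('a)"
  \<comment> \<open>The right-hand side as a measure \<open>\<nu>\<close>, with \<open>J\<close> cut off outside \<open>W\<close> to make it measurable.\<close>
  define g where "g x = ennreal (indicator W x * J x)" for x
  have g: "g \<in> borel_measurable borel"
    using borel_measurable_continuous_on_indicator[OF _ J(1)] W unfolding g_def by simp
  define \<nu> where "\<nu> = density lborel g"
  have sets_\<nu>: "sets \<nu> = sets borel" and space_\<nu>: "space \<nu> = UNIV" by (simp_all add: \<nu>_def)
  have \<nu>: "emeasure \<nu> A = (\<integral>\<^sup>+ x\<in>A. g x \<partial>lborel)" if "A \<in> sets borel" for A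
    using that g by (simp add: \<nu>_def emeasure_density)
  have \<nu>E: "emeasure \<nu> E = (\<integral>\<^sup>+ x\<in>E. ennreal (J x) \<partial>lborel)"
    using E by (auto simp: \<nu> g_def intro!: nn_integral_cong split: split_indicator)
  have cont: "continuous_on W \<phi>"
  proof (rule continuous_at_imp_continuous_on, rule ballI)
    fix x assume "x \<in> W"
    then obtain T r where Tr: "0 < r" "scales_volume T (J x)"
      "\<And>u v. u \<in> ball x r \<Longrightarrow> v \<in> ball x r \<Longrightarrow> dist (\<phi> u) (\<phi> v) \<le> 2 * dist (T u) (T v)"
      using loc[of x 2] by auto
    have "isCont T x" using Tr(2) by (simp add: scales_volume_def linear_continuous_at linear_conv_bounded_linear)
    then have "((\<lambda>u. 2 * dist (T u) (T x)) \<longlongrightarrow> 2 * dist (T x) (T x)) (at x)"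
      by (intro tendsto_intros) (auto simp: isCont_def)
    moreover have "eventually (\<lambda>u. dist (\<phi> u) (\<phi> x) \<le> 2 * dist (T u) (T x)) (at x)"
      using Tr(1,3) by (auto simp: eventually_at dist_commute intro!: exI[of _ r])
    ultimately have "((\<lambda>u. dist (\<phi> u) (\<phi> x)) \<longlongrightarrow> 0) (at x)"
      using tendsto_sandwich[of "\<lambda>_. 0" "\<lambda>u. dist (\<phi> u) (\<phi> x)" "at x" "\<lambda>u. 2 * dist (T u) (T x)" 0]
      by simp
    then show "isCont \<phi> x" unfolding isCont_def by (subst tendsto_dist_iff)
  qed
  have main: "?H (\<phi> ` E) \<le> ennreal (\<tau> ^ Suc DIM('a)) * emeasure \<nu> E \<and>
      emeasure \<nu> E \<le> ennreal (\<tau> ^ Suc DIM('a)) * ?H (\<phi> ` E)" if \<tau>: "1 < \<tau>" for \<tau>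
  proof -
    let ?q = "ennreal (\<tau> ^ Suc DIM('a))"
    have "\<exists>r>0. ball x r \<subseteq> W \<and> (\<exists>T. scales_volume T (J x) \<and>
        (\<forall>u\<in>ball x r. \<forall>v\<in>ball x r.
          dist (\<phi> u) (\<phi> v) \<le> \<tau> * dist (T u) (T v) \<and> dist (T u) (T v) \<le> \<tau> * dist (\<phi> u) (\<phi> v))) \<and>
        (\<forall>y\<in>ball x r. J y \<le> \<tau> * J x \<and> J x \<le> \<tau> * J y)" if x: "x \<in> W" for x
    proof -
      obtain T r1 where T: "0 < r1" "scales_volume T (J x)" "\<forall>u\<in>ball x r1. \<forall>v\<in>ball x r1.
        dist (\<phi> u) (\<phi> v) \<le> \<tau> * dist (T u) (T v) \<and> dist (T u) (T v) \<le> \<tau> * dist (\<phi> u) (\<phi> v)"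
        using loc[OF x \<tau>] by blast
      obtain r2 where r2: "0 < r2" "ball x r2 \<subseteq> W" using W x open_contains_ball by metis
      have "isCont J x" using J(1) W x continuous_on_eq_continuous_at by blast
      then obtain r3 where r3: "0 < r3" "\<And>y. y \<in> ball x r3 \<Longrightarrow> J y \<le> \<tau> * J x \<and> J x \<le> \<tau> * J y"
        using continuous_ratio_close[OF _ _ \<tau>] J(2)[OF x] by metis
      define r where "r = min (min r1 r2) r3"
      have r: "0 < r" "r \<le> r1" "r \<le> r2" "r \<le> r3" using T(1) r2(1) r3(1) by (auto simp: r_def)
      have "\<forall>y\<in>ball x r. J y \<le> \<tau> * J x \<and> J x \<le> \<tau> * J y"
        using r3(2) r(4) by auto
      moreover have "ball x r \<subseteq> W" using r r2(2) by auto
      moreover have "\<forall>u\<in>ball x r. \<forall>v\<in>ball x r.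
        dist (\<phi> u) (\<phi> v) \<le> \<tau> * dist (T u) (T v) \<and> dist (T u) (T v) \<le> \<tau> * dist (\<phi> u) (\<phi> v)"
        using T(3) r(2) by auto
      ultimately show ?thesis using T(2) r(1) by (intro exI[of _ r] exI[of _ T] conjI)
    qed
    then obtain r where r: "\<And>x. x \<in> W \<Longrightarrow> 0 < r x" "\<And>x. x \<in> W \<Longrightarrow> ball x (r x) \<subseteq> W"
      "\<And>x. x \<in> W \<Longrightarrow> \<exists>T. scales_volume T (J x) \<and>
        (\<forall>u\<in>ball x (r x). \<forall>v\<in>ball x (r x).
          dist (\<phi> u) (\<phi> v) \<le> \<tau> * dist (T u) (T v) \<and> dist (T u) (T v) \<le> \<tau> * dist (\<phi> u) (\<phi> v))"
      "\<And>x y. x \<in> W \<Longrightarrow> y \<in> ball x (r x) \<Longrightarrow> J y \<le> \<tau> * J x \<and> J x \<le> \<tau> * J y"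
      by metis
    have comp: "emeasure \<nu> K \<le> ennreal \<tau> * (ennreal (J x) * emeasure lborel K)"
      "ennreal (J x) * emeasure lborel K \<le> ennreal \<tau> * emeasure \<nu> K"
      if x: "x \<in> W" and K: "K \<subseteq> ball x (r x)" "K \<in> sets borel" for x K
    proof -
      have KW: "K \<subseteq> W" using K(1) r(2)[OF x] by blast
      have "emeasure \<nu> K \<le> (\<integral>\<^sup>+ y. ennreal (\<tau> * J x) * indicator K y \<partial>lborel)"
        unfolding \<nu>[OF K(2)] using r(4)[OF x] K(1) KW
        by (intro nn_integral_mono) (auto simp: g_def intro!: ennreal_leI split: split_indicator)
      also have "\<dots> = ennreal (\<tau> * J x) * emeasure lborel K"
        using K(2) by (intro nn_integral_cmult_indicator) simp
      also have "\<dots> = ennreal \<tau> * (ennreal (J x) * emeasure lborel K)"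
        using \<tau> J(2)[OF x] by (simp add: ennreal_mult mult.assoc)
      finally show "emeasure \<nu> K \<le> ennreal \<tau> * (ennreal (J x) * emeasure lborel K)" .
      have "ennreal (J x) * emeasure lborel K = (\<integral>\<^sup>+ y. ennreal (J x) * indicator K y \<partial>lborel)"
        using K(2) by (simp add: nn_integral_cmult_indicator)
      also have "\<dots> \<le> (\<integral>\<^sup>+ y. ennreal \<tau> * (g y * indicator K y) \<partial>lborel)"
      proof (intro nn_integral_mono)
        fix y
        have "ennreal (J x) \<le> ennreal \<tau> * ennreal (J y)" if "y \<in> K"
          using r(4)[OF x] K(1) that \<tau> by (subst ennreal_mult'[symmetric]) (auto intro!: ennreal_leI)
        then show "ennreal (J x) * indicator K y \<le> ennreal \<tau> * (g y * indicator K y)"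
          using KW by (auto simp: g_def split: split_indicator)
      qed
      also have "\<dots> = ennreal \<tau> * emeasure \<nu> K"
        unfolding \<nu>[OF K(2)] using g K(2) by (intro nn_integral_cmult) simp
      finally show "ennreal (J x) * emeasure lborel K \<le> ennreal \<tau> * emeasure \<nu> K" .
    qed
    \<comment> \<open>The formula for sets inside one of the small balls, up to the factor \<open>?q\<close>.\<close>
    have up: "?H (\<phi> ` K) \<le> ?q * emeasure \<nu> K" and lo: "emeasure \<nu> K \<le> ?q * ?H (\<phi> ` K)"
      if x: "x \<in> W" and K: "K \<subseteq> ball x (r x)" "K \<in> sets borel" for x K
    proof -
      obtain T where T: "scales_volume T (J x)" "\<And>u v. u \<in> K \<Longrightarrow> v \<in> K \<Longrightarrow>
          dist (\<phi> u) (\<phi> v) \<le> \<tau> * dist (T u) (T v) \<and> dist (T u) (T v) \<le> \<tau> * dist (\<phi> u) (\<phi> v)"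
        using r(3)[OF x] K(1) by blast
      have q: "ennreal (\<tau> ^ DIM('a)) * (ennreal \<tau> * z) = ?q * z"
        "ennreal \<tau> * (ennreal (\<tau> ^ DIM('a)) * z) = ?q * z" for z
        using \<tau> by (simp_all add: ennreal_mult mult_ac)
      have "0 < \<tau>" using \<tau> by simp
      note bl = hausdorff_measure_image_bilipschitz[OF T(1) K(2) \<open>0 < \<tau>\<close> T(2)]
      show "?H (\<phi> ` K) \<le> ?q * emeasure \<nu> K"
        using order_trans[OF bl(1) mult_left_mono[OF comp(2)[OF x K]]] by (simp only: q zero_le)
      show "emeasure \<nu> K \<le> ?q * ?H (\<phi> ` K)"
        using order_trans[OF comp(1)[OF x K] mult_left_mono[OF bl(2)]] by (simp only: q zero_le)
    qed
    obtain \<B> where \<B>: "\<B> \<subseteq> (\<lambda>x. ball x (r x)) ` W" "countable \<B>" "\<Union>\<B> = \<Union>((\<lambda>x. ball x (r x)) ` W)"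
      using Lindelof[of "(\<lambda>x. ball x (r x)) ` W"] by auto
    obtain X where X: "X \<subseteq> W" "countable X" "\<B> = (\<lambda>x. ball x (r x)) ` X"
      using \<B>(1,2) countable_subset_image[of \<B> "\<lambda>x. ball x (r x)" W] by metis
    have WX: "W \<subseteq> (\<Union>x\<in>X. ball x (r x))" using \<B>(3) r(1) unfolding X(3) by force
    have "X \<noteq> {}" using WX False by blast
    define x where "x = from_nat_into X"
    have range_x: "range x = X" using X(2) \<open>X \<noteq> {}\<close> by (simp add: x_def)
    have xW: "x i \<in> W" for i using range_x X(1) by blast
    define B where "B i = ball (x i) (r (x i))" for i
    \<comment> \<open>The balls are made disjoint, so that the pieces \<open>P i\<close> partition \<open>E\<close>.\<close>
    define P where "P i = E \<inter> disjointed B i" for i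
    have B: "B i \<in> sets borel" for i by (simp add: B_def)
    have P: "P i \<in> sets borel" "P i \<subseteq> B i" for i
      using E(1) sets.range_disjointed_sets[of B borel] B disjointed_subset[of B i] by (auto simp: P_def)
    have disjP: "disjoint_family P"
      using disjoint_family_disjointed[of B] unfolding P_def disjoint_family_on_def by blast
    have UP: "(\<Union>i. P i) = E"
    proof -
      have "E \<subseteq> (\<Union>i. B i)" using E(2) WX range_x unfolding B_def by blast
      then show ?thesis using UN_disjointed_eq[of B] unfolding P_def by blast
    qed
    have sumP: "(\<Sum>i. emeasure \<nu> (P i)) = emeasure \<nu> E"
      using P(1) disjP UP by (subst suminf_emeasure) (auto simp: sets_\<nu>)
    have "?H (\<phi> ` E) = ?H (\<Union>i. \<phi> ` P i)" using UP by (metis image_UN)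
    also have "\<dots> \<le> (\<Sum>i. ?H (\<phi> ` P i))" by (rule hausdorff_measure_UN_le)
    also have "\<dots> \<le> (\<Sum>i. ?q * emeasure \<nu> (P i))"
      by (intro suminf_le up[OF xW P(2)[unfolded B_def] P(1)]) auto
    also have "\<dots> = ?q * emeasure \<nu> E" by (simp add: sumP)
    finally have upper: "?H (\<phi> ` E) \<le> ?q * emeasure \<nu> E" .
    have finP: "emeasure \<nu> (P i) < \<infinity>" for i
    proof -
      have "emeasure lborel (P i) < \<infinity>"
        using P(2)[of i] emeasure_bounded_finite[of "P i"] bounded_subset[of "B i" "P i"] by (simp add: B_def)
      then have "ennreal \<tau> * (ennreal (J (x i)) * emeasure lborel (P i)) < \<infinity>"
        by (simp add: ennreal_mult_less_top)
      then show ?thesis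
        using comp(1)[OF xW P(2)[unfolded B_def] P(1)] by (rule le_less_trans[rotated])
    qed
    \<comment> \<open>Inner regularity is applied to the restriction of \<open>\<nu>\<close> to \<open>P i\<close>, which is a finite measure.\<close>
    have inner: "\<exists>K. compact K \<and> K \<subseteq> P i \<and> emeasure \<nu> (P i) \<le> emeasure \<nu> K + ennreal e"
      if "0 < e" for i e
    proof -
      let ?M = "density \<nu> (indicator (P i))"
      have M: "emeasure ?M A = emeasure \<nu> (P i \<inter> A)" if "A \<in> sets borel" for A
        using that P(1) by (intro emeasure_restricted) (auto simp: sets_\<nu>)
      have "emeasure ?M (P i) = (SUP K\<in>{K. K \<subseteq> P i \<and> compact K}. emeasure ?M K)"
        using M[of UNIV] finP[of i] P(1) by (intro inner_regular) (auto simp: sets_\<nu> space_\<nu>)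
      also have "\<dots> = (SUP K\<in>{K. K \<subseteq> P i \<and> compact K}. emeasure \<nu> K)"
        by (rule SUP_cong) (auto simp: M compact_imp_closed Int_absorb1)
      finally have sup: "emeasure \<nu> (P i) = (SUP K\<in>{K. K \<subseteq> P i \<and> compact K}. emeasure \<nu> K)"
        using M[OF P(1)] by simp
      have "{K. K \<subseteq> P i \<and> compact K} \<noteq> {}" by blast
      then have "\<exists>K\<in>{K. K \<subseteq> P i \<and> compact K}. emeasure \<nu> (P i) < emeasure \<nu> K + ennreal e"
        using finP[of i] by (intro SUP_approx_ennreal[OF that _ sup]) simp_all
      then show ?thesis by (auto intro: less_imp_le)
    qed
    \<comment> \<open>Superadditivity: the images of compact subsets of different \<open>P i\<close> are disjoint and compact.\<close>
    have part: "(\<Sum>i<n. emeasure \<nu> (P i)) \<le> ?q * ?H (\<phi> ` E)" for n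
    proof (rule ennreal_le_epsilon)
      fix e :: real assume "0 < e"
      then have "0 < e / (n + 1)" by simp
      from inner[OF this] obtain K where K: "\<And>i. compact (K i)" "\<And>i. K i \<subseteq> P i"
        "\<And>i. emeasure \<nu> (P i) \<le> emeasure \<nu> (K i) + ennreal (e / (n + 1))" by metis
      have KW: "K i \<subseteq> W" for i using K(2) UP E(2) by blast
      have "(\<Sum>i<n. emeasure \<nu> (P i)) \<le> (\<Sum>i<n. emeasure \<nu> (K i) + ennreal (e / (n + 1)))"
        by (intro sum_mono K(3))
      also have "\<dots> = (\<Sum>i<n. emeasure \<nu> (K i)) + of_nat n * ennreal (e / (n + 1))"
        by (simp add: sum.distrib)
      also have "\<dots> \<le> ?q * ?H (\<phi> ` E) + ennreal e"
      proof (rule add_mono)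
        have "(\<Sum>i<n. emeasure \<nu> (K i)) \<le> (\<Sum>i<n. ?q * ?H (\<phi> ` K i))"
          by (intro sum_mono lo[OF xW order_trans[OF K(2) P(2)[unfolded B_def]]])
            (simp add: K(1) compact_imp_closed)
        also have "\<dots> = ?q * (\<Sum>i<n. ?H (\<phi> ` K i))" by (rule sum_distrib_left[symmetric])
        also have "(\<Sum>i<n. ?H (\<phi> ` K i)) \<le> ?H (\<Union>i<n. \<phi> ` K i)"
        proof (rule hausdorff_measure_sum_compact_le)
          show "compact (\<phi> ` K i)" for i
            using K(1) KW cont continuous_on_subset compact_continuous_image by blast
          show "disjoint_family_on (\<lambda>i. \<phi> ` K i) {..<n}"
            unfolding disjoint_family_on_def
          proof (intro ballI impI)
            fix i j :: nat assume "i \<noteq> j"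
            then have "K i \<inter> K j = {}" using K(2) disjP unfolding disjoint_family_on_def by blast
            then show "\<phi> ` K i \<inter> \<phi> ` K j = {}"
              using inj_on_image_Int[OF inj KW KW] by (metis image_empty)
          qed
        qed simp
        also have "?H (\<Union>i<n. \<phi> ` K i) \<le> ?H (\<phi> ` E)"
          using K(2) UP by (intro hausdorff_measure_mono) blast
        finally show "(\<Sum>i<n. emeasure \<nu> (K i)) \<le> ?q * ?H (\<phi> ` E)" by (simp add: mult_left_mono)
        have "of_nat n * ennreal (e / (n + 1)) = ennreal (n * (e / (n + 1)))"
          using \<open>0 < e\<close> by (subst ennreal_mult) (simp_all add: ennreal_of_nat_eq_real_of_nat)
        also have "\<dots> \<le> ennreal e" using \<open>0 < e\<close> by (intro ennreal_leI) (simp add: field_simps)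
        finally show "of_nat n * ennreal (e / (n + 1)) \<le> ennreal e" .
      qed
      finally show "(\<Sum>i<n. emeasure \<nu> (P i)) \<le> ?q * ?H (\<phi> ` E) + ennreal e" .
    qed
    have "emeasure \<nu> E \<le> ?q * ?H (\<phi> ` E)"
      unfolding sumP[symmetric] using part by (intro suminf_le_const) auto
    with upper show ?thesis by blast
  qed
  have "?H (\<phi> ` E) = emeasure \<nu> E"
    by (rule antisym; rule ennreal_le_of_le_power_mult) (use main in blast)+
  then show ?thesis using \<nu>E by simp
qed

section \<open>Volume factors of linear maps, and locally Lipschitz images\<close>

text \<open>
  The measure \<open>E \<mapsto> emeasure lborel (T ` E) / c\<close> agrees with Lebesgue measure on boxes, hence on all
  Borel sets.
\<close>

lemma scales_volumeI:
  fixes T :: "'a::euclidean_space \<Rightarrow> 'a"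
  assumes T: "linear T" "inj T" and c: "0 < c"
    and box: "\<And>l u. emeasure lborel (T ` box l u) = ennreal c * emeasure lborel (box l u)"
  shows "scales_volume T c"
proof -
  obtain S where S: "linear S" "\<And>x. S (T x) = x" "\<And>x. T (S x) = x"
    using linear_injective_isomorphism[OF T] by metis
  have image: "T ` E = S -` E" for E
    using S(2,3) by (auto simp: image_iff) metis
  have contS: "continuous_on UNIV S" using S(1) by (simp add: linear_continuous_on linear_conv_bounded_linear)
  then have S_meas: "S \<in> borel_measurable borel" by (rule borel_measurable_continuous_onI)
  define M where "M = scale_measure (ennreal (1 / c)) (distr lborel borel S)"
  have M: "emeasure M E = ennreal (1 / c) * emeasure lborel (T ` E)" if "E \<in> sets borel" for E
    using that S_meas by (simp add: M_def emeasure_distr image)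
  have "lborel = M"
  proof (rule lborel_eqI)
    fix l u :: 'a assume lu: "\<And>b. b \<in> Basis \<Longrightarrow> l \<bullet> b \<le> u \<bullet> b"
    have "emeasure M (box l u) = emeasure lborel (box l u)"
      using c by (simp add: M box ennreal_inverse_mult_cancel)
    then show "emeasure M (box l u) = (\<Prod>b\<in>Basis. (u - l) \<bullet> b)"
      using lu by (simp add: emeasure_lborel_box_eq)
  qed (simp add: M_def)
  have "emeasure lborel (T ` E) = ennreal c * emeasure lborel E" if "E \<in> sets borel" for E
    using M[OF that] c unfolding \<open>lborel = M\<close>[symmetric] by (simp add: ennreal_inverse_mult_cancel)
  moreover have "T ` E \<in> sets borel" if "E \<in> sets borel" for E
    using measurable_sets[OF S_meas that] by (simp add: image)
  ultimately show ?thesis using T(1) by (simp add: scales_volume_def)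
qed

lemma linear_inj_if_expanding:
  assumes "\<And>v. norm v \<le> C * norm (T v)" "linear T"
  shows "inj T"
  using assms by (auto simp: linear_injective_0) (metis mult_zero_right norm_le_zero_iff norm_zero)

lemma scales_volume_scaleR:
  assumes "0 < c"
  shows "scales_volume (\<lambda>x::'a::euclidean_space. c *\<^sub>R x) (c ^ DIM('a))"
proof (rule scales_volumeI)
  fix l u :: 'a
  have img: "(\<lambda>x. c *\<^sub>R x) ` box l u \<in> sets borel"
    using assms open_scaling[of c "box l u"] by (auto intro!: borel_open)
  have "emeasure lebesgue ((\<lambda>x. c *\<^sub>R x) ` box l u) = ennreal (c ^ DIM('a)) * emeasure lebesgue (box l u)"
    using emeasure_lebesgue_affine[of c 0 "box l u"] assms by (simp add: ennreal_power)
  then show "emeasure lborel ((\<lambda>x. c *\<^sub>R x) ` box l u) = ennreal (c ^ DIM('a)) * emeasure lborel (box l u)"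
    using img by simp
qed (use assms in \<open>auto simp: inj_on_def linear_scale_self\<close>)

lemma scales_volume_map_prod:
  fixes S :: "'a::euclidean_space \<Rightarrow> 'a" and T :: "'b::euclidean_space \<Rightarrow> 'b"
  assumes S: "scales_volume S c" "inj S" "0 < c" and T: "scales_volume T d" "inj T" "0 < d"
  shows "scales_volume (map_prod S T) (c * d)"
proof (rule scales_volumeI)
  have "linear S" "linear T" using S(1) T(1) by (simp_all add: scales_volume_def)
  then show "linear (map_prod S T)"
    by (auto intro!: linearI simp: linear_add linear_cmul)
  show "inj (map_prod S T)" using S(2) T(2) by (rule prod.inj_map)
  show "0 < c * d" using S(3) T(3) by simp
  fix l u :: "'a \<times> 'b"
  have prod: "emeasure lborel (A \<times> B) = emeasure lborel A * emeasure lborel B"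
    if "A \<in> sets borel" "B \<in> sets borel" for A :: "'a set" and B :: "'b set"
    using that by (simp add: lborel_prod[symmetric] lborel.emeasure_pair_measure_Times)
  have "map_prod S T ` box l u = (S ` box (fst l) (fst u)) \<times> (T ` box (snd l) (snd u))"
    by (subst box_prod) (rule map_prod_image)
  moreover have "emeasure lborel (box l u) = emeasure lborel (box (fst l) (fst u)) * emeasure lborel (box (snd l) (snd u))"
    by (subst box_prod) (simp add: prod)
  ultimately show "emeasure lborel (map_prod S T ` box l u) = ennreal (c * d) * emeasure lborel (box l u)"
    using S T by (simp add: prod scales_volume_def ennreal_mult mult_ac)
qed

lemma hausdorff_measure_isometry_image:
  assumes "\<And>x y. x \<in> E \<Longrightarrow> y \<in> E \<Longrightarrow> dist (g x) (g y) = dist x y"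
  shows "hausdorff_measure m (g ` E) = hausdorff_measure m E"
  using hausdorff_measure_lipschitz[of 1 E g id m] hausdorff_measure_lipschitz[of 1 E id g m] assms
  by (intro antisym) simp_all

text \<open>
  The graph map \<open>w \<mapsto> (w, g \<bullet> w)\<close> is not a map of the space to itself, but up to an isometry of its
  image it is the map \<open>S\<close>: rotate \<open>g\<close> onto a coordinate axis and stretch that axis by
  \<open>sqrt (1 + norm g ^ 2)\<close>.  That the rotation preserves volume is read off from the fact that
  Lebesgue measure is a Hausdorff measure.
\<close>

lemma scales_volume_gradient:
  fixes g :: "real ^ 'n"
  obtains S where "scales_volume S (sqrt (1 + (norm g)\<^sup>2))" "inj S"
    "\<And>w. (norm (S w))\<^sup>2 = (norm w)\<^sup>2 + (g \<bullet> w)\<^sup>2"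
proof -
  fix k :: 'n
  define s where "s = sqrt (1 + (norm g)\<^sup>2)"
  have s: "0 < s" "s\<^sup>2 = 1 + (norm g)\<^sup>2" by (simp_all add: s_def add_pos_nonneg)
  have "norm g = norm (norm g *\<^sub>R axis k (1::real))" by (simp add: norm_axis_1)
  then obtain R :: "real ^ 'n \<Rightarrow> real ^ 'n" where R: "orthogonal_transformation R" "R g = norm g *\<^sub>R axis k 1"
    by (rule orthogonal_transformation_exists) (rule that, assumption+)
  define m where "m j = (if j = k then s else 1)" for j
  define S where "S w = (\<chi> j. m j * (R w $ j))" for w
  have Rk: "norm g * (R w $ k) = g \<bullet> w" for w
  proof -
    have "R g \<bullet> R w = g \<bullet> w" using R(1) by (simp add: orthogonal_transformation_def)
    then show ?thesis by (simp add: R(2) inner_axis' )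
  qed
  have normS: "(norm (S w))\<^sup>2 = (norm w)\<^sup>2 + (g \<bullet> w)\<^sup>2" for w
  proof -
    have nsq: "(norm z)\<^sup>2 = (z $ k)\<^sup>2 + (\<Sum>j\<in>UNIV - {k}. (z $ j)\<^sup>2)" for z :: "real ^ 'n"
      by (simp add: norm_vec_def L2_set_def sum_nonneg sum.remove[of UNIV k])
    have "(norm (S w))\<^sup>2 = s\<^sup>2 * (R w $ k)\<^sup>2 + (\<Sum>j\<in>UNIV - {k}. (R w $ j)\<^sup>2)"
      unfolding nsq by (simp add: S_def m_def power_mult_distrib)
    also have "\<dots> = (norm (R w))\<^sup>2 + (norm g * (R w $ k))\<^sup>2"
      unfolding nsq[of "R w"] s(2) by (simp add: algebra_simps power_mult_distrib)
    finally show ?thesis using R(1) by (simp add: Rk orthogonal_transformation_norm)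
  qed
  have lin: "linear S"
    using R(1) by (auto intro!: linearI simp: S_def vec_eq_iff orthogonal_transformation_def linear_add linear_cmul algebra_simps)
  have inj: "inj S"
  proof (rule linear_inj_if_expanding[where C = 1, OF _ lin])
    fix w
    have "(norm w)\<^sup>2 \<le> (norm (S w))\<^sup>2" unfolding normS by simp
    then have "norm w \<le> norm (S w)" by (rule power2_le_imp_le) simp
    then show "norm w \<le> 1 * norm (S w)" by simp
  qed
  have "scales_volume S s"
  proof (rule scales_volumeI[OF lin inj s(1)])
    fix l u :: "real ^ 'n"
    have linR: "linear R" and injR: "inj R"
      using R(1) by (simp_all add: orthogonal_transformation_linear orthogonal_transformation_inj)
    have "open (R ` box l u)"
      using open_surjective_linear_image[OF open_box linR linear_injective_imp_surjective[OF linR injR refl]] .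
    moreover have "dist (R x) (R y) = dist x y" for x y
      using R(1) linear_diff[OF linR, of x y] by (metis dist_norm orthogonal_transformation_norm)
    then have "hausdorff_measure DIM(real ^ 'n) (R ` box l u) = hausdorff_measure DIM(real ^ 'n) (box l u)"
      by (rule hausdorff_measure_isometry_image)
    ultimately have "emeasure lborel (R ` box l u) = emeasure lborel (box l u)"
      by (simp only: hausdorff_measure_eq_lborel borel_open open_box)
    moreover have "R ` box l u \<in> lmeasurable"
      using \<open>open (R ` box l u)\<close> bounded_linear_image[OF bounded_box] linR
      by (intro lmeasurable_open) (auto simp: linear_conv_bounded_linear)
    ultimately have Rm: "R ` box l u \<in> lmeasurable" "measure lebesgue (R ` box l u) = measure lebesgue (box l u)"
      using \<open>open (R ` box l u)\<close> by (simp_all add: measure_def)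
    have img: "S ` box l u = (\<lambda>x. \<chi> j. m j * x $ j) ` R ` box l u"
      by (auto simp: S_def image_image)
    have "S ` box l u \<in> lmeasurable"
      unfolding img by (rule measurable_stretch[OF Rm(1)])
    moreover have "measure lebesgue (S ` box l u) = s * measure lebesgue (box l u)"
      unfolding img measure_stretch[OF Rm(1)] Rm(2) using s(1) by (simp add: m_def)
    ultimately have "emeasure lebesgue (S ` box l u) = ennreal s * emeasure lebesgue (box l u)"
      using s(1) by (simp add: emeasure_eq_measure2 lmeasurable_box ennreal_mult)
    moreover have "S ` box l u \<in> sets borel"
      using open_surjective_linear_image[OF open_box lin linear_injective_imp_surjective[OF lin inj refl]] by simp
    ultimately show "emeasure lborel (S ` box l u) = ennreal s * emeasure lborel (box l u)"
      by simp
  qed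
  then show ?thesis using that inj normS by (simp add: s_def)
qed

text \<open>
  The mean value inequality on a small ball for \<open>f\<close> minus its linear part at \<open>x\<close>, whose gradient is
  small by continuity.
\<close>

lemma strictly_differentiable:
  fixes f :: "'a::real_inner \<Rightarrow> real"
  assumes \<Omega>: "open \<Omega>" "x \<in> \<Omega>" and f: "\<And>y. y \<in> \<Omega> \<Longrightarrow> (f has_derivative (\<lambda>w. g y \<bullet> w)) (at y)"
    and g: "continuous_on \<Omega> g" and "0 < e"
  obtains r where "0 < r" "ball x r \<subseteq> \<Omega>"
    "\<And>y z. y \<in> ball x r \<Longrightarrow> z \<in> ball x r \<Longrightarrow> \<bar>(f y - f z) - g x \<bullet> (y - z)\<bar> \<le> e * norm (y - z)"
proof -
  have "isCont g x" using \<Omega> g continuous_on_eq_continuous_at by blast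
  then obtain r1 where r1: "0 < r1" "\<And>y. dist y x < r1 \<Longrightarrow> dist (g y) (g x) < e"
    using \<open>0 < e\<close> unfolding continuous_at_eps_delta by blast
  obtain r2 where r2: "0 < r2" "ball x r2 \<subseteq> \<Omega>" using \<Omega> open_contains_ball by metis
  define r where "r = min r1 r2"
  have r: "0 < r" "ball x r \<subseteq> \<Omega>" using r1 r2 by (auto simp: r_def)
  have "\<bar>(f y - f z) - g x \<bullet> (y - z)\<bar> \<le> e * norm (y - z)" if yz: "y \<in> ball x r" "z \<in> ball x r" for y z
  proof -
    have "norm ((f y - g x \<bullet> y) - (f z - g x \<bullet> z)) \<le> e * norm (y - z)"
    proof (rule differentiable_bound[where S = "ball x r" and f' = "\<lambda>u w. (g u - g x) \<bullet> w"])
      fix u assume u: "u \<in> ball x r"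
      have "((\<lambda>y. f y - g x \<bullet> y) has_derivative (\<lambda>w. g u \<bullet> w - g x \<bullet> w)) (at u)"
        using f u r(2) by (intro derivative_intros) auto
      then show "((\<lambda>y. f y - g x \<bullet> y) has_derivative (\<lambda>w. (g u - g x) \<bullet> w)) (at u within ball x r)"
        by (simp add: inner_diff_left has_derivative_at_withinI)
      have "norm ((g u - g x) \<bullet> w) \<le> e * norm w" for w
      proof -
        have "norm (g u - g x) \<le> e" using r1(2)[of u] u by (simp add: r_def dist_norm norm_minus_commute)
        then show ?thesis
          using Cauchy_Schwarz_ineq2[of "g u - g x" w] mult_right_mono[of _ e "norm w"]
          by (metis norm_ge_zero order_trans real_norm_def)
      qed
      then show "onorm (\<lambda>w. (g u - g x) \<bullet> w) \<le> e"
        using \<open>0 < e\<close> by (intro onorm_bound) auto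
    qed (use yz in auto)
    then show ?thesis by (simp add: inner_diff_right algebra_simps)
  qed
  then show ?thesis using that r by blast
qed

lemma hausdorff_measure_image_locally_null:
  fixes \<phi> :: "'a::{metric_space, second_countable_topology} \<Rightarrow> 'b::metric_space"
  assumes "\<And>x. x \<in> S \<Longrightarrow> \<exists>r>0. hausdorff_measure m (\<phi> ` (S \<inter> ball x r)) = 0"
  shows "hausdorff_measure m (\<phi> ` S) = 0"
proof (cases "S = {}")
  case False
  obtain r where r: "\<And>x. x \<in> S \<Longrightarrow> 0 < r x" "\<And>x. x \<in> S \<Longrightarrow> hausdorff_measure m (\<phi> ` (S \<inter> ball x (r x))) = 0"
    using assms by metis
  obtain \<B> where \<B>: "\<B> \<subseteq> (\<lambda>x. ball x (r x)) ` S" "countable \<B>" "\<Union>\<B> = \<Union>((\<lambda>x. ball x (r x)) ` S)"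
    using Lindelof[of "(\<lambda>x. ball x (r x)) ` S"] by auto
  have S: "S \<subseteq> \<Union>\<B>" unfolding \<B>(3) using r(1) by force
  then have "\<B> \<noteq> {}" using False by auto
  then obtain h :: "nat \<Rightarrow> 'a set" where h: "range h = \<B>"
    using \<B>(2) range_from_nat_into by metis
  have "\<phi> ` S \<subseteq> (\<Union>i. \<phi> ` (S \<inter> h i))"
  proof
    fix z assume "z \<in> \<phi> ` S"
    then obtain x where x: "x \<in> S" "z = \<phi> x" by blast
    then obtain i where "x \<in> h i" using S h by blast
    then show "z \<in> (\<Union>i. \<phi> ` (S \<inter> h i))" using x by blast
  qed
  moreover have "hausdorff_measure m (\<phi> ` (S \<inter> h i)) = 0" for i
  proof -
    have "h i \<in> \<B>" using h by blast
    then obtain x where "x \<in> S" "h i = ball x (r x)" using \<B>(1) by blast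
    then show ?thesis using r(2) by simp
  qed
  ultimately show ?thesis
    using hausdorff_measure_mono hausdorff_measure_UN_null by (metis le_zero_eq)
qed simp

section \<open>Stereographic projection\<close>

text \<open>
  The space \<open>'a\<close> is identified by \<open>\<iota>\<close> with the hyperplane orthogonal to the pole \<open>p\<close>.
\<close>

locale stereographic =
  fixes \<iota> :: "'a::euclidean_space \<Rightarrow> 'b::euclidean_space" and p :: 'b
  assumes linear_\<iota>: "linear \<iota>" and inner_\<iota>: "\<And>s t. \<iota> s \<bullet> \<iota> t = s \<bullet> t"
    and norm_p: "norm p = 1" and \<iota>_p: "\<And>t. \<iota> t \<bullet> p = 0" and range_\<iota>: "\<And>x. x \<bullet> p = 0 \<Longrightarrow> x \<in> range \<iota>"
begin

text \<open>
  The conformal factor of the inverse stereographic projection \<open>\<psi>\<close> below.  In terms of it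
  the usual formula \<open>(2 t + (norm t ^ 2 - 1) p) / (norm t ^ 2 + 1)\<close> becomes an affine combination of
  \<open>\<iota> t\<close> and \<open>p\<close>.
\<close>

definition conf :: "'a \<Rightarrow> real" where
  "conf t = 2 / (1 + (norm t)\<^sup>2)"

definition \<psi> :: "'a \<Rightarrow> 'b" where
  "\<psi> t = conf t *\<^sub>R \<iota> t + (1 - conf t) *\<^sub>R p"

lemma conf_pos: "0 < conf t"
  by (simp add: conf_def add_pos_nonneg)

lemma conf_norm: "conf t * (1 + (norm t)\<^sup>2) = 2"
proof -
  have "1 + (norm t)\<^sup>2 \<noteq> 0" by (smt (verit) zero_le_power2)
  then show ?thesis
    unfolding conf_def times_divide_eq_left by (rule nonzero_mult_div_cancel_right)
qed

lemma continuous_on_conf: "continuous_on S conf"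
proof -
  have "1 + (norm t)\<^sup>2 \<noteq> 0" for t :: 'a by (smt (verit) zero_le_power2)
  then show ?thesis unfolding conf_def by (intro continuous_intros) auto
qed

lemma inner_\<psi>: "\<psi> s \<bullet> \<psi> t = 1 - conf s * conf t * (norm (s - t))\<^sup>2 / 2"
proof -
  have "p \<bullet> p = 1" using norm_p by (simp add: norm_eq_1)
  moreover have "p \<bullet> \<iota> u = 0" for u by (metis \<iota>_p inner_commute)
  ultimately have \<psi>\<psi>: "\<psi> s \<bullet> \<psi> t = conf s * conf t * (s \<bullet> t) + (1 - conf s) * (1 - conf t)"
    by (simp add: \<psi>_def inner_simps inner_\<iota> \<iota>_p)
  have diff: "(norm (s - t))\<^sup>2 = (norm s)\<^sup>2 + (norm t)\<^sup>2 - 2 * (s \<bullet> t)"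
    by (simp add: power2_norm_eq_inner inner_simps inner_commute)
  moreover have "conf s * conf t * ((norm s)\<^sup>2 + (norm t)\<^sup>2) = conf t * (2 - conf s) + conf s * (2 - conf t)"
  proof -
    have "conf u * (norm u)\<^sup>2 = 2 - conf u" for u using conf_norm[of u] by (simp add: algebra_simps)
    then have "conf t * (conf s * (norm s)\<^sup>2) + conf s * (conf t * (norm t)\<^sup>2)
        = conf t * (2 - conf s) + conf s * (2 - conf t)" by simp
    then show ?thesis by (simp add: algebra_simps)
  qed
  ultimately have "conf s * conf t * (norm (s - t))\<^sup>2
      = conf t * (2 - conf s) + conf s * (2 - conf t) - 2 * (conf s * conf t * (s \<bullet> t))"
    unfolding diff right_diff_distrib by simp
  with \<psi>\<psi> show ?thesis by (simp add: algebra_simps)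
qed

lemma norm_\<psi>: "norm (\<psi> t) = 1"
  using inner_\<psi>[of t t] by (simp add: norm_eq_1)

text \<open>
  The exact form of conformality; it replaces the computation of the differential of \<open>\<psi>\<close>.
\<close>

lemma dist_\<psi>: "(dist (\<psi> s) (\<psi> t))\<^sup>2 = conf s * conf t * (dist s t)\<^sup>2"
proof -
  have "(dist (\<psi> s) (\<psi> t))\<^sup>2 = 2 - 2 * (\<psi> s \<bullet> \<psi> t)"
    using norm_\<psi>[of s] norm_\<psi>[of t]
    by (simp add: dist_norm power2_norm_eq_inner inner_simps inner_commute norm_eq_1)
  then show ?thesis by (simp add: inner_\<psi> dist_norm)
qed

lemma inj_\<psi>: "inj \<psi>"
proof (rule injI)
  fix s t assume "\<psi> s = \<psi> t"
  then have "conf s * conf t * (dist s t)\<^sup>2 = 0" using dist_\<psi>[of s t] by simp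
  then show "s = t" using conf_pos[of s] conf_pos[of t] by simp
qed

lemma range_\<psi>:
  assumes "norm x = 1" "x \<noteq> p"
  shows "x \<in> range \<psi>"
proof -
  define h where "h = x \<bullet> p"
  have pp: "p \<bullet> p = 1" "x \<bullet> x = 1" using norm_p assms(1) by (simp_all add: norm_eq_1)
  have h1: "h < 1"
  proof -
    have "0 < (x - p) \<bullet> (x - p)" using assms(2) by simp
    then show ?thesis using pp by (simp add: h_def inner_simps inner_commute)
  qed
  have "(1 / (1 - h)) *\<^sub>R (x - h *\<^sub>R p) \<bullet> p = 0" by (simp add: inner_simps pp h_def)
  then obtain t where t: "\<iota> t = (1 / (1 - h)) *\<^sub>R (x - h *\<^sub>R p)" using range_\<iota> by (metis rangeE)
  have "(norm t)\<^sup>2 = (1 / (1 - h))\<^sup>2 * (1 - h\<^sup>2)"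
  proof -
    have "(norm t)\<^sup>2 = \<iota> t \<bullet> \<iota> t" by (simp add: inner_\<iota> power2_norm_eq_inner)
    also have "\<dots> = (1 / (1 - h))\<^sup>2 * ((x - h *\<^sub>R p) \<bullet> (x - h *\<^sub>R p))" by (simp add: t power2_eq_square)
    also have "(x - h *\<^sub>R p) \<bullet> (x - h *\<^sub>R p) = 1 - h\<^sup>2"
      by (simp add: inner_simps pp inner_commute[of p x] h_def[symmetric] power2_eq_square)
    finally show ?thesis .
  qed
  also have "1 - h\<^sup>2 = (1 - h) * (1 + h)" by (simp add: algebra_simps power2_eq_square)
  also have "(1 / (1 - h))\<^sup>2 * ((1 - h) * (1 + h)) = (1 + h) / (1 - h)"
    using h1 by (simp add: power2_eq_square)
  finally have "1 + (norm t)\<^sup>2 = 2 / (1 - h)" using h1 by (simp add: field_simps)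
  then have "conf t = 1 - h" using h1 by (simp add: conf_def)
  then have "\<psi> t = x" using h1 by (simp add: \<psi>_def t)
  then show ?thesis by blast
qed

lemma sphere_eq: "sphere 0 1 = insert p (range \<psi>)"
proof (intro set_eqI iffI)
  fix x assume "x \<in> sphere (0 :: 'b) 1"
  then show "x \<in> insert p (range \<psi>)" using range_\<psi>[of x] by (cases "x = p") auto
qed (auto simp: norm_p norm_\<psi>)

text \<open>
  The area formula for \<open>\<psi>\<close>, whose image misses only the pole.
\<close>

lemma hausdorff_measure_sphere: "hausdorff_measure DIM('a) (sphere (0::'b) 1) = (\<integral>\<^sup>+ t. ennreal (conf t ^ DIM('a)) \<partial>lborel)"
proof -
  have "hausdorff_measure DIM('a) (\<psi> ` UNIV) = (\<integral>\<^sup>+ t\<in>UNIV. ennreal (conf t ^ DIM('a)) \<partial>lborel)"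
  proof (rule area_formula[of UNIV])
    show "continuous_on UNIV (\<lambda>t. conf t ^ DIM('a))" by (intro continuous_intros continuous_on_conf)
    fix x :: 'a and \<tau> :: real assume \<tau>: "1 < \<tau>"
    have "isCont conf x" using continuous_on_conf[of UNIV] by (simp add: continuous_on_eq_continuous_at)
    then obtain r where r: "0 < r" "\<And>t. t \<in> ball x r \<Longrightarrow> conf t \<le> \<tau> * conf x \<and> conf x \<le> \<tau> * conf t"
      using continuous_ratio_close[OF \<open>isCont conf x\<close> conf_pos \<tau>] by metis
    show "\<exists>T r. 0 < r \<and> scales_volume T (conf x ^ DIM('a)) \<and>
      (\<forall>u\<in>ball x r. \<forall>v\<in>ball x r.
        dist (\<psi> u) (\<psi> v) \<le> \<tau> * dist (T u) (T v) \<and> dist (T u) (T v) \<le> \<tau> * dist (\<psi> u) (\<psi> v))"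
    proof (intro exI conjI ballI)
      show "scales_volume (\<lambda>t::'a. conf x *\<^sub>R t) (conf x ^ DIM('a))" by (rule scales_volume_scaleR[OF conf_pos])
      fix u v assume uv: "u \<in> ball x r" "v \<in> ball x r"
      have T: "(dist (conf x *\<^sub>R u) (conf x *\<^sub>R v))\<^sup>2 = (conf x * conf x) * (dist u v)\<^sup>2"
        using conf_pos[of x] by (simp add: dist_norm scaleR_diff_right[symmetric] power_mult_distrib power2_eq_square)
      have "conf u * conf v \<le> (\<tau> * conf x) * (\<tau> * conf x)" "conf x * conf x \<le> (\<tau> * conf u) * (\<tau> * conf v)"
        using r(2)[OF uv(1)] r(2)[OF uv(2)] conf_pos[of x] conf_pos[of u] conf_pos[of v] \<tau>
        by (intro mult_mono; simp)+
      then have "(conf u * conf v) * (dist u v)\<^sup>2 \<le> ((\<tau> * conf x) * (\<tau> * conf x)) * (dist u v)\<^sup>2"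
        "(conf x * conf x) * (dist u v)\<^sup>2 \<le> ((\<tau> * conf u) * (\<tau> * conf v)) * (dist u v)\<^sup>2"
        by (auto intro!: mult_right_mono)
      then have "(dist (\<psi> u) (\<psi> v))\<^sup>2 \<le> (\<tau> * dist (conf x *\<^sub>R u) (conf x *\<^sub>R v))\<^sup>2"
        "(dist (conf x *\<^sub>R u) (conf x *\<^sub>R v))\<^sup>2 \<le> (\<tau> * dist (\<psi> u) (\<psi> v))\<^sup>2"
        by (simp_all add: power_mult_distrib T dist_\<psi> power2_eq_square[of \<tau>] mult_ac)
      then show "dist (\<psi> u) (\<psi> v) \<le> \<tau> * dist (conf x *\<^sub>R u) (conf x *\<^sub>R v)"
        "dist (conf x *\<^sub>R u) (conf x *\<^sub>R v) \<le> \<tau> * dist (\<psi> u) (\<psi> v)"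
        using \<tau> by (auto intro: power2_le_imp_le)
    qed (rule r(1))
  qed (use inj_\<psi> conf_pos in auto)
  moreover have "hausdorff_measure DIM('a) (insert p (range \<psi>)) = hausdorff_measure DIM('a) (range \<psi>)"
  proof (rule antisym)
    have "hausdorff_measure DIM('a) ({p} \<union> range \<psi>) \<le> hausdorff_measure DIM('a) {p} + hausdorff_measure DIM('a) (range \<psi>)"
      by (rule hausdorff_measure_Un_le)
    then show "hausdorff_measure DIM('a) (insert p (range \<psi>)) \<le> hausdorff_measure DIM('a) (range \<psi>)"
      by (simp add: hausdorff_measure_singleton)
  qed (rule hausdorff_measure_mono, blast)
  ultimately show ?thesis by (simp add: sphere_eq)
qed

end

section \<open>Warped products with a sphere\<close>

text \<open>
  The triangle inequality for the vectors \<open>(a, d)\<close> and \<open>(b, d)\<close>, which differ by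
  at most \<open>(\<tau> - 1) * d\<close>.
\<close>

lemma sum_squares_le_of_close:
  fixes a b d :: real
  assumes "1 \<le> \<tau>" "0 \<le> d" "\<bar>a - b\<bar> \<le> (\<tau> - 1) * d"
  shows "a\<^sup>2 + d\<^sup>2 \<le> \<tau>\<^sup>2 * (b\<^sup>2 + d\<^sup>2)"
proof -
  have "d \<le> norm (b, d)" using assms(2) by (simp add: norm_Pair real_le_rsqrt)
  then have "(\<tau> - 1) * d \<le> (\<tau> - 1) * norm (b, d)" using assms(1) by (intro mult_left_mono) auto
  moreover have "norm (a, d) \<le> norm (b, d) + norm (a - b, 0::real)"
    using norm_triangle_ineq[of "(b, d)" "(a - b, 0)"] by simp
  ultimately have "norm (a, d) \<le> \<tau> * norm (b, d)"
    using assms(3) by (simp add: norm_Pair algebra_simps)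
  then have "(norm (a, d))\<^sup>2 \<le> (\<tau> * norm (b, d))\<^sup>2" by (intro power_mono) auto
  then show ?thesis by (simp add: norm_Pair power_mult_distrib)
qed

lemma dist_Pair_power2: "(dist (a, b) (c, d))\<^sup>2 = (dist a c)\<^sup>2 + (dist b d)\<^sup>2"
  by (simp add: dist_Pair_Pair)

context stereographic
begin

definition warp :: "('c \<Rightarrow> real) \<Rightarrow> 'a \<times> 'c \<Rightarrow> 'b \<times> 'c" where
  "warp f = (\<lambda>(t, y). (f y *\<^sub>R \<psi> t, y))"

text \<open>
  For unit vectors \<open>\<alpha>\<close> and \<open>\<beta>\<close> and real \<open>a\<close>, \<open>b\<close>, the squared distance of \<open>a \<alpha>\<close> and \<open>b \<beta>\<close> is
  \<open>(a - b) ^ 2\<close> plus \<open>a * b\<close> times the squared distance of \<open>\<alpha>\<close> and \<open>\<beta>\<close>.  The radial and the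
  spherical directions thus separate without any error term.
\<close>

lemma dist_warp:
  fixes y z :: "'c::metric_space"
  shows "(dist (warp f (s, y)) (warp f (t, z)))\<^sup>2 =
    (f y * conf s) * (f z * conf t) * (dist s t)\<^sup>2 + ((f y - f z)\<^sup>2 + (dist y z)\<^sup>2)"
proof -
  have n: "\<psi> u \<bullet> \<psi> u = 1" for u using norm_\<psi>[of u] by (simp add: norm_eq_1)
  have "(dist (f y *\<^sub>R \<psi> s) (f z *\<^sub>R \<psi> t))\<^sup>2 = (f y)\<^sup>2 + (f z)\<^sup>2 - 2 * (f y * f z) * (\<psi> s \<bullet> \<psi> t)"
    unfolding dist_norm power2_norm_eq_inner
    by (simp add: inner_simps n inner_commute power2_eq_square)
  also have "\<dots> = (f y - f z)\<^sup>2 + (f y * conf s) * (f z * conf t) * (dist s t)\<^sup>2"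
    by (simp add: inner_\<psi> dist_norm power2_eq_square algebra_simps)
  finally show ?thesis by (simp add: warp_def dist_Pair_power2)
qed

text \<open>
  The two parts of \<open>dist_warp\<close> are compared separately with their linear models: the
  coefficients \<open>f y * conf s\<close> by continuity, and the difference \<open>f y - f z\<close> by strict
  differentiability at \<open>y0\<close>.
\<close>

lemma warp_locally_close_to_linear:
  fixes f :: "real ^ 'm \<Rightarrow> real"
  assumes \<Omega>: "open \<Omega>" "y0 \<in> \<Omega>" "0 < f y0"
    and f: "\<And>y. y \<in> \<Omega> \<Longrightarrow> (f has_derivative (\<lambda>w. g y \<bullet> w)) (at y)" and g: "continuous_on \<Omega> g"
    and \<tau>: "1 < \<tau>"
  shows "\<exists>T r. 0 < r \<and>
    scales_volume T ((f y0 * conf t0) ^ DIM('a) * sqrt (1 + (norm (g y0))\<^sup>2)) \<and>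
    (\<forall>u\<in>ball (t0, y0) r. \<forall>v\<in>ball (t0, y0) r.
        dist (warp f u) (warp f v) \<le> \<tau> * dist (T u) (T v) \<and> dist (T u) (T v) \<le> \<tau> * dist (warp f u) (warp f v))"
proof -
  define h where "h = (\<lambda>(t, y). f y * conf t)"
  define h0 where "h0 = f y0 * conf t0"
  have "0 < h0" using \<Omega>(3) conf_pos by (simp add: h0_def)
  have "isCont f y0" using f[OF \<Omega>(2)] has_derivative_continuous by blast
  moreover have "isCont conf t0" using continuous_on_conf[of UNIV] by (simp add: continuous_on_eq_continuous_at)
  ultimately have "isCont (\<lambda>x. f (snd x)) (t0, y0)" "isCont (\<lambda>x. conf (fst x)) (t0, y0)"
    by (simp_all add: isCont_o2[OF isCont_snd[OF continuous_ident]] isCont_o2[OF isCont_fst[OF continuous_ident]])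
  then have "isCont (\<lambda>x. f (snd x) * conf (fst x)) (t0, y0)"
    by (rule continuous_mult)
  then have "isCont h (t0, y0)" by (simp add: h_def case_prod_beta')
  moreover have "0 < h (t0, y0)" using \<open>0 < h0\<close> by (simp add: h_def h0_def)
  ultimately obtain r1 where r1: "0 < r1"
    "\<And>x. x \<in> ball (t0, y0) r1 \<Longrightarrow> h x \<le> \<tau> * h (t0, y0) \<and> h (t0, y0) \<le> \<tau> * h x"
    using continuous_ratio_close[OF _ _ \<tau>] by metis
  have "0 < \<tau> - 1" using \<tau> by simp
  obtain r2 where r2: "0 < r2"
    "\<And>y z. y \<in> ball y0 r2 \<Longrightarrow> z \<in> ball y0 r2 \<Longrightarrow> \<bar>(f y - f z) - g y0 \<bullet> (y - z)\<bar> \<le> (\<tau> - 1) * norm (y - z)"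
    using strictly_differentiable[OF \<Omega>(1,2) f g \<open>0 < \<tau> - 1\<close>] by metis
  obtain S where S: "scales_volume S (sqrt (1 + (norm (g y0))\<^sup>2))" "inj S"
    "\<And>w. (norm (S w))\<^sup>2 = (norm w)\<^sup>2 + (g y0 \<bullet> w)\<^sup>2"
    using scales_volume_gradient by metis
  have linS: "linear S" using S(1) by (simp add: scales_volume_def)
  \<comment> \<open>The linear model of the chart: a homothety in \<open>t\<close> and the stretched graph map of \<open>f\<close> in \<open>y\<close>.\<close>
  define T where "T = map_prod (\<lambda>t::'a. h0 *\<^sub>R t) S"
  have "0 < sqrt (1 + (norm (g y0))\<^sup>2)" by (simp add: add_pos_nonneg)
  then have T: "scales_volume T (h0 ^ DIM('a) * sqrt (1 + (norm (g y0))\<^sup>2))"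
    unfolding T_def using \<open>0 < h0\<close>
    by (intro scales_volume_map_prod scales_volume_scaleR S) (auto simp: inj_on_def)
  have distT: "(dist (T (s, y)) (T (t, z)))\<^sup>2 = (h0 * h0) * (dist s t)\<^sup>2 + ((g y0 \<bullet> (y - z))\<^sup>2 + (dist y z)\<^sup>2)"
    for s t y z
  proof -
    have "(dist (h0 *\<^sub>R s) (h0 *\<^sub>R t))\<^sup>2 = (h0 * h0) * (dist s t)\<^sup>2"
      by (simp add: dist_norm scaleR_diff_right[symmetric] power_mult_distrib power2_eq_square)
    moreover have "(dist (S y) (S z))\<^sup>2 = (g y0 \<bullet> (y - z))\<^sup>2 + (dist y z)\<^sup>2"
      using S(3)[of "y - z"] linear_diff[OF linS, of y z] by (simp add: dist_norm)
    ultimately show ?thesis by (simp add: T_def dist_Pair_power2)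
  qed
  define r where "r = min r1 r2"
  have "dist (warp f u) (warp f v) \<le> \<tau> * dist (T u) (T v) \<and> dist (T u) (T v) \<le> \<tau> * dist (warp f u) (warp f v)"
    if uv: "u \<in> ball (t0, y0) r" "v \<in> ball (t0, y0) r" for u v
  proof -
    obtain s y t z where [simp]: "u = (s, y)" "v = (t, z)" by (cases u; cases v)
    have "dist y0 y \<le> dist (t0, y0) (s, y)" "dist y0 z \<le> dist (t0, y0) (t, z)"
      using dist_snd_le[of "(t0, y0)" "(s, y)"] dist_snd_le[of "(t0, y0)" "(t, z)"] by simp_all
    then have yz: "y \<in> ball y0 r2" "z \<in> ball y0 r2" using uv by (auto simp: r_def)
    have b: "\<bar>(f y - f z) - g y0 \<bullet> (y - z)\<bar> \<le> (\<tau> - 1) * dist y z"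
      using r2(2)[OF yz] by (simp add: dist_norm)
    then have b': "\<bar>g y0 \<bullet> (y - z) - (f y - f z)\<bar> \<le> (\<tau> - 1) * dist y z" by linarith
    define p q where "p = f y * conf s" and "q = f z * conf t"
    have "p \<le> \<tau> * h0 \<and> h0 \<le> \<tau> * p" "q \<le> \<tau> * h0 \<and> h0 \<le> \<tau> * q"
      using r1(2)[of u] r1(2)[of v] uv by (auto simp: r_def h_def h0_def p_def q_def)
    moreover from this have "0 < p" "0 < q"
      using \<open>0 < h0\<close> \<tau> by (smt (verit) zero_less_mult_pos)+
    ultimately have "p * q \<le> (\<tau> * h0) * (\<tau> * h0)" "h0 * h0 \<le> (\<tau> * p) * (\<tau> * q)"
      using \<open>0 < h0\<close> \<tau> by (intro mult_mono; simp)+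
    then have "p * q * (dist s t)\<^sup>2 \<le> (\<tau> * h0) * (\<tau> * h0) * (dist s t)\<^sup>2"
      "h0 * h0 * (dist s t)\<^sup>2 \<le> (\<tau> * p) * (\<tau> * q) * (dist s t)\<^sup>2"
      by (auto intro!: mult_right_mono)
    moreover have "(f y - f z)\<^sup>2 + (dist y z)\<^sup>2 \<le> \<tau>\<^sup>2 * ((g y0 \<bullet> (y - z))\<^sup>2 + (dist y z)\<^sup>2)"
      "(g y0 \<bullet> (y - z))\<^sup>2 + (dist y z)\<^sup>2 \<le> \<tau>\<^sup>2 * ((f y - f z)\<^sup>2 + (dist y z)\<^sup>2)"
      using b b' \<tau> by (intro sum_squares_le_of_close; simp)+
    ultimately have "(dist (warp f u) (warp f v))\<^sup>2 \<le> \<tau>\<^sup>2 * (dist (T u) (T v))\<^sup>2"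
      "(dist (T u) (T v))\<^sup>2 \<le> \<tau>\<^sup>2 * (dist (warp f u) (warp f v))\<^sup>2"
      unfolding \<open>u = _\<close> \<open>v = _\<close> dist_warp distT p_def[symmetric] q_def[symmetric] distrib_left[of "\<tau>\<^sup>2"]
      by (auto intro!: add_mono simp: power2_eq_square[of \<tau>] mult_ac)
    then have "(dist (warp f u) (warp f v))\<^sup>2 \<le> (\<tau> * dist (T u) (T v))\<^sup>2"
      "(dist (T u) (T v))\<^sup>2 \<le> (\<tau> * dist (warp f u) (warp f v))\<^sup>2"
      by (simp_all add: power_mult_distrib)
    then show ?thesis using \<tau> by (auto intro: power2_le_imp_le)
  qed
  then show ?thesis
    using T r1(1) r2(1) unfolding h0_def by (intro exI[of _ T] exI[of _ r]) (auto simp: r_def)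
qed

text \<open>
  The area formula on \<open>UNIV \<times> U\<close>.  The Jacobian is a product of a function of \<open>t\<close> and a function of
  \<open>y\<close>; by Tonelli the first one integrates to the measure of the sphere.
\<close>

lemma hausdorff_measure_warp_image:
  fixes f :: "real ^ 'm \<Rightarrow> real"
  assumes \<Omega>: "open \<Omega>"
    and f: "\<And>y. y \<in> \<Omega> \<Longrightarrow> (f has_derivative (\<lambda>w. g y \<bullet> w)) (at y)" and g: "continuous_on \<Omega> g"
    and U: "U \<in> sets borel" "U \<subseteq> \<Omega>" and pos: "\<And>y. y \<in> U \<Longrightarrow> 0 < f y"
  shows "hausdorff_measure (DIM('a) + CARD('m)) (warp f ` (UNIV \<times> U)) =
    (\<integral>\<^sup>+ y\<in>U. hausdorff_measure DIM('a) (sphere (0::'b) 1) *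
       ennreal (f y ^ DIM('a) * sqrt (1 + (norm (g y))\<^sup>2)) \<partial>lborel)"
proof -
  define V where "V = {y\<in>\<Omega>. 0 < f y}"
  define W where "W = (UNIV :: 'a set) \<times> V"
  define G where "G y = f y ^ DIM('a) * sqrt (1 + (norm (g y))\<^sup>2)" for y
  define J where "J x = (f (snd x) * conf (fst x)) ^ DIM('a) * sqrt (1 + (norm (g (snd x)))\<^sup>2)" for x
  have contf: "continuous_on \<Omega> f"
    using f has_derivative_continuous by (fastforce intro!: continuous_at_imp_continuous_on)
  have V: "open V" unfolding V_def
    using continuous_open_preimage[OF contf \<Omega>, of "{0<..}"] by (simp add: vimage_def Int_def)
  then have W: "open W" unfolding W_def by (intro open_Times) auto
  have UV: "U \<subseteq> V" using U(2) pos by (auto simp: V_def)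
  have J_eq: "J (t, y) = conf t ^ DIM('a) * G y" for t y by (simp add: J_def G_def power_mult_distrib)
  have area: "hausdorff_measure DIM('a \<times> (real ^ 'm)) (warp f ` (UNIV \<times> U)) = (\<integral>\<^sup>+ x\<in>UNIV \<times> U. ennreal (J x) \<partial>lborel)"
  proof (rule area_formula[OF W])
    show "inj_on (warp f) W"
    proof (rule inj_onI)
      fix u v assume "u \<in> W" "v \<in> W" "warp f u = warp f v"
      then show "u = v"
        using inj_\<psi> by (cases u; cases v) (auto simp: warp_def W_def V_def inj_eq)
    qed
    show "continuous_on W J"
      unfolding J_def W_def
      by (intro continuous_intros continuous_on_compose2[OF contf] continuous_on_compose2[OF g]
          continuous_on_compose2[OF continuous_on_conf[of UNIV]]) (auto simp: V_def)
    show "0 < J x" if "x \<in> W" for x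
    proof -
      have "0 < 1 + (norm (g (snd x)))\<^sup>2" by (simp add: add_pos_nonneg)
      then show ?thesis using that conf_pos by (auto simp: J_def W_def V_def)
    qed
    show "\<exists>T r. 0 < r \<and> scales_volume T (J x) \<and>
      (\<forall>u\<in>ball x r. \<forall>v\<in>ball x r.
        dist (warp f u) (warp f v) \<le> \<tau> * dist (T u) (T v) \<and> dist (T u) (T v) \<le> \<tau> * dist (warp f u) (warp f v))"
      if "x \<in> W" "1 < \<tau>" for x \<tau>
      using that warp_locally_close_to_linear[OF \<Omega> _ _ f g that(2), of "snd x" "fst x"]
      by (auto simp: W_def V_def J_def)
    show "UNIV \<times> U \<in> sets borel" using U(1) by (intro borel_Times) auto
    show "UNIV \<times> U \<subseteq> W" using UV by (auto simp: W_def)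
  qed
  have contG: "continuous_on U G"
    unfolding G_def using U(2) contf g by (intro continuous_intros) (auto intro: continuous_on_subset)
  have "(\<lambda>y. ennreal (indicator U y *\<^sub>R G y)) \<in> borel_measurable borel"
    using borel_measurable_continuous_on_indicator[OF U(1) contG] by simp
  moreover have "ennreal (indicator U y *\<^sub>R G y) = ennreal (G y) * indicator U y" for y
    by (auto split: split_indicator)
  ultimately have measG: "(\<lambda>y. ennreal (G y) * indicator U y) \<in> borel_measurable borel" by simp
  have meas_conf: "(\<lambda>t. ennreal (conf t ^ DIM('a))) \<in> borel_measurable borel"
    using continuous_on_conf[of UNIV] by (intro measurable_compose[OF _ measurable_ennreal] borel_measurable_continuous_onI continuous_intros)
  have "(\<integral>\<^sup>+ x\<in>UNIV \<times> U. ennreal (J x) \<partial>lborel)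
      = (\<integral>\<^sup>+ x. ennreal (conf (fst x) ^ DIM('a)) * (ennreal (G (snd x)) * indicator U (snd x)) \<partial>(lborel \<Otimes>\<^sub>M lborel))"
    unfolding lborel_prod
    using conf_pos by (intro nn_integral_cong)
      (auto simp: J_eq ennreal_mult'[OF zero_le_power] less_imp_le split: split_indicator)
  also have "\<dots> = (\<integral>\<^sup>+ t. \<integral>\<^sup>+ y. ennreal (conf t ^ DIM('a)) * (ennreal (G y) * indicator U y) \<partial>lborel \<partial>lborel)"
    using measG meas_conf by (subst lborel.nn_integral_fst[symmetric]) auto
  also have "\<dots> = (\<integral>\<^sup>+ t. ennreal (conf t ^ DIM('a)) * (\<integral>\<^sup>+ y. ennreal (G y) * indicator U y \<partial>lborel) \<partial>lborel)"
    using measG by (intro nn_integral_cong nn_integral_cmult) simp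
  also have "\<dots> = (\<integral>\<^sup>+ t. ennreal (conf t ^ DIM('a)) \<partial>lborel) * (\<integral>\<^sup>+ y. ennreal (G y) * indicator U y \<partial>lborel)"
    using meas_conf by (intro nn_integral_multc) simp
  also have "\<dots> = (\<integral>\<^sup>+ y. hausdorff_measure DIM('a) (sphere (0::'b) 1) * (ennreal (G y) * indicator U y) \<partial>lborel)"
    unfolding hausdorff_measure_sphere using measG by (intro nn_integral_cmult[symmetric]) simp
  finally show ?thesis
    using area by (simp add: G_def mult.assoc)
qed

text \<open>
  Locally this set is a Lipschitz image of a ball in the base, whose dimension is smaller by
  \<open>DIM('a)\<close>.
\<close>

lemma hausdorff_measure_pole_null:
  fixes f :: "real ^ 'm \<Rightarrow> real"
  assumes \<Omega>: "open \<Omega>"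
    and f: "\<And>y. y \<in> \<Omega> \<Longrightarrow> (f has_derivative (\<lambda>w. g y \<bullet> w)) (at y)" and g: "continuous_on \<Omega> g"
    and U: "U \<subseteq> \<Omega>"
  shows "hausdorff_measure (DIM('a) + CARD('m)) ((\<lambda>y. (f y *\<^sub>R p, y)) ` U) = 0"
proof (rule hausdorff_measure_image_locally_null)
  fix x assume "x \<in> U"
  then have "x \<in> \<Omega>" using U by blast
  obtain r where r: "0 < r" "\<And>y z. y \<in> ball x r \<Longrightarrow> z \<in> ball x r \<Longrightarrow> \<bar>(f y - f z) - g x \<bullet> (y - z)\<bar> \<le> 1 * norm (y - z)"
    using strictly_differentiable[OF \<Omega> \<open>x \<in> \<Omega>\<close> f g zero_less_one] by metis
  define L where "L = norm (g x) + 2"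
  have "0 < L" by (simp add: L_def add_nonneg_pos)
  let ?\<phi> = "\<lambda>y. (f y *\<^sub>R p, y)" and ?m = "CARD('m)"
  have lip: "dist (?\<phi> y) (?\<phi> z) \<le> L * dist (id y) (id z)" if "y \<in> U \<inter> ball x r" "z \<in> U \<inter> ball x r" for y z
  proof -
    have "dist (?\<phi> y) (?\<phi> z) = norm ((f y - f z) *\<^sub>R p, y - z)"
      by (simp add: dist_norm scaleR_diff_left)
    also have "\<dots> \<le> \<bar>f y - f z\<bar> + norm (y - z)"
      using norm_Pair_le[of "(f y - f z) *\<^sub>R p" "y - z"] norm_p by simp
    also have "\<bar>f y - f z\<bar> \<le> norm (y - z) + norm (g x) * norm (y - z)"
      using r(2)[of y z] that Cauchy_Schwarz_ineq2[of "g x" "y - z"] by auto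
    finally show ?thesis by (simp add: L_def dist_norm algebra_simps)
  qed
  have "hausdorff_measure ?m (?\<phi> ` (U \<inter> ball x r)) \<le> ennreal (L ^ ?m) * hausdorff_measure ?m (id ` (U \<inter> ball x r))"
    by (rule hausdorff_measure_lipschitz[OF \<open>0 < L\<close> lip])
  also have "hausdorff_measure ?m (id ` (U \<inter> ball x r)) \<le> hausdorff_measure ?m (ball x r)"
    by (intro hausdorff_measure_mono) auto
  also have "hausdorff_measure ?m (ball x r) = emeasure lborel (ball x r)"
    using hausdorff_measure_eq_lborel[of "ball x r"] by simp
  also have "ennreal (L ^ ?m) * emeasure lborel (ball x r) < \<infinity>"
    using emeasure_bounded_finite[of "ball x r"] by (simp add: ennreal_mult_less_top)
  finally have "hausdorff_measure ?m (?\<phi> ` (U \<inter> ball x r)) < \<infinity>" by (simp add: mult_left_mono)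
  then have "hausdorff_measure (DIM('a) + ?m) (?\<phi> ` (U \<inter> ball x r)) = 0"
    by (rule hausdorff_measure_higher_dim_null) simp
  then show "\<exists>r>0. hausdorff_measure (DIM('a) + ?m) (?\<phi> ` (U \<inter> ball x r)) = 0" using r(1) by blast
qed

text \<open>
  The points that the chart \<open>warp f\<close> misses, over the pole or where \<open>f\<close> vanishes, all have
  the form \<open>(f y *\<^sub>R p, y)\<close>.  Where \<open>f\<close> vanishes, so does the integrand, as \<open>DIM('a)\<close> is positive.
\<close>

lemma hausdorff_measure_warped_product_borel:
  fixes f :: "real ^ 'm \<Rightarrow> real"
  assumes \<Omega>: "open \<Omega>" and nonneg: "\<And>y. y \<in> \<Omega> \<Longrightarrow> 0 \<le> f y"
    and f: "\<And>y. y \<in> \<Omega> \<Longrightarrow> (f has_derivative (\<lambda>w. g y \<bullet> w)) (at y)" and g: "continuous_on \<Omega> g"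
    and U: "U \<in> sets borel" "U \<subseteq> \<Omega>"
  shows "hausdorff_measure (DIM('a) + CARD('m)) {(v :: 'b, y). y \<in> U \<and> norm v = f y} =
    (\<integral>\<^sup>+ y\<in>U. hausdorff_measure DIM('a) (sphere (0::'b) 1) *
       ennreal (f y ^ DIM('a) * sqrt (1 + (norm (g y))\<^sup>2)) \<partial>lborel)"
proof -
  let ?H = "hausdorff_measure (DIM('a) + CARD('m))"
  let ?M = "{(v :: 'b, y). y \<in> U \<and> norm v = f y}"
  define V where "V = U \<inter> {y\<in>\<Omega>. 0 < f y}"
  let ?A = "warp f ` (UNIV \<times> V)" and ?P = "(\<lambda>y. (f y *\<^sub>R p, y)) ` U"
  have contf: "continuous_on \<Omega> f"
    using f has_derivative_continuous by (fastforce intro!: continuous_at_imp_continuous_on)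
  have "open {y\<in>\<Omega>. 0 < f y}"
    using continuous_open_preimage[OF contf \<Omega>, of "{0<..}"] by (simp add: vimage_def Int_def)
  then have V: "V \<in> sets borel" "V \<subseteq> \<Omega>" "\<And>y. y \<in> V \<Longrightarrow> 0 < f y"
    using U by (auto simp: V_def)
  have sub: "?A \<subseteq> ?M"
    using U(2) nonneg norm_\<psi> by (auto simp: warp_def V_def)
  have "(v, y) \<in> ?A \<union> ?P" if vy: "y \<in> U" "norm v = f y" for v y
  proof -
    consider "f y = 0" | "0 < f y" "v = f y *\<^sub>R p" | "0 < f y" "v \<noteq> f y *\<^sub>R p"
      using nonneg[of y] vy(1) U(2) by force
    then show ?thesis
    proof cases
      case 1
      then show ?thesis using vy by (auto intro!: image_eqI[of _ _ y])
    next
      case 2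
      then show ?thesis using vy by blast
    next
      case 3
      define x where "x = (1 / f y) *\<^sub>R v"
      have v: "v = f y *\<^sub>R x" using 3(1) by (simp add: x_def)
      have "norm x = 1" using 3(1) vy(2) by (simp add: x_def)
      moreover have "x \<noteq> p" using 3(2) v by blast
      ultimately obtain t where "x = \<psi> t" using range_\<psi> by blast
      then have "(v, y) = warp f (t, y)" by (simp add: warp_def v)
      moreover have "y \<in> V" using vy(1) U(2) 3(1) by (auto simp: V_def)
      ultimately show ?thesis by blast
    qed
  qed
  then have "?M \<subseteq> ?A \<union> ?P" by blast
  then have "?H ?M \<le> ?H (?A \<union> ?P)" by (rule hausdorff_measure_mono)
  also have "\<dots> \<le> ?H ?A + ?H ?P" by (rule hausdorff_measure_Un_le)
  also have "?H ?P = 0" by (rule hausdorff_measure_pole_null[OF \<Omega> f g U(2)])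
  finally have "?H ?M \<le> ?H ?A" by simp
  then have "?H ?M = ?H ?A" using hausdorff_measure_mono[OF sub] by (rule antisym)
  also have "\<dots> = (\<integral>\<^sup>+ y\<in>V. hausdorff_measure DIM('a) (sphere (0::'b) 1) *
       ennreal (f y ^ DIM('a) * sqrt (1 + (norm (g y))\<^sup>2)) \<partial>lborel)"
    by (rule hausdorff_measure_warp_image[OF \<Omega> f g V])
  also have "\<dots> = (\<integral>\<^sup>+ y\<in>U. hausdorff_measure DIM('a) (sphere (0::'b) 1) *
       ennreal (f y ^ DIM('a) * sqrt (1 + (norm (g y))\<^sup>2)) \<partial>lborel)"
  proof (intro nn_integral_cong)
    fix y
    have "y \<in> V \<or> y \<notin> U \<or> f y = 0" using nonneg[of y] U(2) by (force simp: V_def)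
    then show "hausdorff_measure DIM('a) (sphere (0::'b) 1) *
       ennreal (f y ^ DIM('a) * sqrt (1 + (norm (g y))\<^sup>2)) * indicator V y =
       hausdorff_measure DIM('a) (sphere (0::'b) 1) *
       ennreal (f y ^ DIM('a) * sqrt (1 + (norm (g y))\<^sup>2)) * indicator U y"
      by (auto simp: V_def split: split_indicator)
  qed
  finally show ?thesis .
qed

text \<open>
  A Lebesgue measurable \<open>U\<close> lies between Borel sets \<open>C\<close> and \<open>D\<close> that differ by a null set, and
  both sides are monotone in \<open>U\<close> and agree for \<open>C\<close> and \<open>D\<close>.
\<close>

lemma hausdorff_measure_warped_product:
  fixes f :: "real ^ 'm \<Rightarrow> real"
  assumes \<Omega>: "open \<Omega>" and nonneg: "\<And>y. y \<in> \<Omega> \<Longrightarrow> 0 \<le> f y"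
    and f: "\<And>y. y \<in> \<Omega> \<Longrightarrow> (f has_derivative (\<lambda>w. g y \<bullet> w)) (at y)" and g: "continuous_on \<Omega> g"
    and U: "U \<in> sets lebesgue" "U \<subseteq> \<Omega>"
  shows "hausdorff_measure (DIM('a) + CARD('m)) {(v :: 'b, y). y \<in> U \<and> norm v = f y} =
    (\<integral>\<^sup>+ y\<in>U. hausdorff_measure DIM('a) (sphere (0::'b) 1) *
       ennreal (f y ^ DIM('a) * sqrt (1 + (norm (g y))\<^sup>2)) \<partial>lebesgue)"
proof -
  let ?H = "\<lambda>U. hausdorff_measure (DIM('a) + CARD('m)) {(v :: 'b, y). y \<in> U \<and> norm v = f y}"
  let ?h = "\<lambda>y. hausdorff_measure DIM('a) (sphere (0::'b) 1) *
       ennreal (f y ^ DIM('a) * sqrt (1 + (norm (g y))\<^sup>2))"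
  obtain C N N' where C: "U = C \<union> N" "N \<subseteq> N'" "N' \<in> null_sets lborel" "C \<in> sets lborel"
    using sets_completionE[OF U(1)] by metis
  define D where "D = C \<union> (N' \<inter> \<Omega>)"
  have borel: "C \<in> sets borel" "D \<in> sets borel"
    using C(3,4) \<Omega> by (auto simp: D_def null_sets_def)
  have sub: "C \<subseteq> U" "U \<subseteq> D" "D \<subseteq> \<Omega>" using C(1,2) U(2) by (auto simp: D_def)
  have AE: "AE y in lborel. y \<notin> N'" using C(3) by (rule AE_not_in)
  have "AE y in lborel. ?h y * indicator D y = ?h y * indicator C y"
    using AE by eventually_elim (auto simp: D_def split: split_indicator)
  then have CD: "(\<integral>\<^sup>+ y\<in>D. ?h y \<partial>lborel) = (\<integral>\<^sup>+ y\<in>C. ?h y \<partial>lborel)"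
    by (rule nn_integral_cong_AE)
  have "AE y in lborel. ?h y * indicator U y = ?h y * indicator C y"
    using AE by eventually_elim (use C(1,2) in \<open>auto split: split_indicator\<close>)
  then have UC: "(\<integral>\<^sup>+ y\<in>U. ?h y \<partial>lborel) = (\<integral>\<^sup>+ y\<in>C. ?h y \<partial>lborel)"
    by (rule nn_integral_cong_AE)
  have "C \<subseteq> \<Omega>" using sub by blast
  have HC: "?H C = (\<integral>\<^sup>+ y\<in>C. ?h y \<partial>lborel)"
    using hausdorff_measure_warped_product_borel[OF \<Omega> nonneg f g borel(1) \<open>C \<subseteq> \<Omega>\<close>] .
  have HD: "?H D = (\<integral>\<^sup>+ y\<in>D. ?h y \<partial>lborel)"
    using hausdorff_measure_warped_product_borel[OF \<Omega> nonneg f g borel(2) sub(3)] .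
  have "?H U = (\<integral>\<^sup>+ y\<in>C. ?h y \<partial>lborel)"
  proof (rule antisym)
    have "?H U \<le> ?H D" using sub(2) by (intro hausdorff_measure_mono) auto
    then show "?H U \<le> (\<integral>\<^sup>+ y\<in>C. ?h y \<partial>lborel)" using HD CD by simp
    have "?H C \<le> ?H U" using sub(1) by (intro hausdorff_measure_mono) auto
    then show "(\<integral>\<^sup>+ y\<in>C. ?h y \<partial>lborel) \<le> ?H U" using HC by simp
  qed
  then show ?thesis using UC by (simp add: nn_integral_completion)
qed

end

section \<open>Spherical arrays in coordinates\<close>

text \<open>
  An index type with one element less than \<open>'k\<close>, for the coordinates orthogonal to the pole
  \<open>axis undefined 1\<close>.  Types are not empty, so nothing is removed from a type with one element.
\<close>

typedef 'k equator = "{i :: 'k. CARD('k) = 1 \<or> i \<noteq> undefined}"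
proof (cases "CARD('k) = 1")
  case False
  then have "UNIV \<noteq> {undefined :: 'k}" by (metis is_singletonI is_singleton_altdef)
  then show ?thesis by blast
qed auto

instance equator :: (finite) finite
proof
  have "UNIV = Abs_equator ` (UNIV :: 'a set)" by (metis Abs_equator_cases surjI surj_def UNIV_I UNIV_eq_I image_eqI)
  then show "finite (UNIV :: 'a equator set)" by (metis finite finite_imageI)
qed

lemma bij_betw_Rep_equator:
  assumes "CARD('k) \<noteq> 1"
  shows "bij_betw Rep_equator (UNIV :: 'k equator set) (UNIV - {undefined})"
proof (rule bij_betwI')
  show "Rep_equator x = Rep_equator y \<longleftrightarrow> x = y" for x y :: "'k equator" by (rule Rep_equator_inject)
  show "Rep_equator x \<in> UNIV - {undefined}" for x :: "'k equator" using Rep_equator[of x] assms by simp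
  show "\<exists>x\<in>UNIV. y = Rep_equator x" if "y \<in> UNIV - {undefined}" for y :: 'k
    using that Rep_equator_cases[of y] by auto
qed

lemma CARD_equator:
  assumes "CARD('k::finite) \<noteq> 1"
  shows "CARD('k equator) = CARD('k) - 1"
  using bij_betw_same_card[OF bij_betw_Rep_equator[OF assms]] by simp

lemma stereographic_equator:
  assumes "CARD('k::finite) \<noteq> 1"
  shows "stereographic (\<lambda>t :: real ^ 'k equator. (\<chi> i. if i = undefined then 0 else t $ Abs_equator i) :: real ^ 'k)
    (axis undefined 1)"
proof (rule stereographic.intro)
  let ?\<iota> = "\<lambda>t :: real ^ 'k equator. (\<chi> i. if i = undefined then 0 else t $ Abs_equator i) :: real ^ 'k"
  show "linear ?\<iota>" by (rule linearI) (auto simp: vec_eq_iff)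
  show "?\<iota> s \<bullet> ?\<iota> t = s \<bullet> t" for s t
  proof -
    have "?\<iota> s \<bullet> ?\<iota> t = (\<Sum>i\<in>UNIV - {undefined}. s $ Abs_equator i * t $ Abs_equator i)"
      by (simp add: inner_vec_def sum.remove[of UNIV undefined])
    also have "\<dots> = (\<Sum>j\<in>UNIV. s $ Abs_equator (Rep_equator j) * t $ Abs_equator (Rep_equator j))"
      by (rule sum.reindex_bij_betw[OF bij_betw_Rep_equator[OF assms], symmetric])
    finally show ?thesis by (simp add: Rep_equator_inverse inner_vec_def)
  qed
  show "norm (axis undefined 1 :: real ^ 'k) = 1" by (simp add: norm_axis_1)
  show "?\<iota> t \<bullet> axis undefined 1 = 0" for t by (simp add: inner_axis)
  show "x \<in> range ?\<iota>" if "x \<bullet> axis undefined 1 = 0" for x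
  proof
    have "x $ undefined = 0" using that by (simp add: inner_axis)
    then show "x = ?\<iota> (\<chi> j. x $ Rep_equator j)"
      by (auto simp: vec_eq_iff Abs_equator_inverse)
  qed simp
qed

text \<open>
  The vector of the partial derivatives represents the Frechet derivative, and inherits its
  continuity.
\<close>

lemma gradient_of_C1_on:
  fixes f :: "real ^ 'm \<Rightarrow> real"
  assumes "C1_on \<Omega> f"
  shows "\<And>y. y \<in> \<Omega> \<Longrightarrow> (f has_derivative (\<lambda>w. (\<chi> j. partial_deriv j f y) \<bullet> w)) (at y)"
    and "continuous_on \<Omega> (\<lambda>y. \<chi> j. partial_deriv j f y)"
proof -
  obtain f' where f': "\<And>x. x \<in> \<Omega> \<Longrightarrow> (f has_derivative blinfun_apply (f' x)) (at x)" "continuous_on \<Omega> f'"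
    using assms by (auto simp: C1_on_def)
  have pd: "partial_deriv j f y = blinfun_apply (f' y) (axis j 1)" if "y \<in> \<Omega>" for j y
  proof -
    have "((\<lambda>t. y + t *\<^sub>R axis j 1) has_derivative (\<lambda>t. t *\<^sub>R axis j 1)) (at (0::real))"
      by (auto intro!: derivative_eq_intros)
    moreover have "(f has_derivative blinfun_apply (f' y)) (at (y + 0 *\<^sub>R axis j 1))"
      using f'(1)[OF that] by simp
    ultimately have "((\<lambda>t. f (y + t *\<^sub>R axis j 1)) has_derivative (\<lambda>t. blinfun_apply (f' y) (t *\<^sub>R axis j 1))) (at 0)"
      by (rule has_derivative_compose)
    then have "((\<lambda>t. f (y + t *\<^sub>R axis j 1)) has_field_derivative blinfun_apply (f' y) (axis j 1)) (at 0)"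
      by (simp add: has_field_derivative_def blinfun.scaleR_right mult_commute_abs)
    then show ?thesis unfolding partial_deriv_def by (rule DERIV_imp_deriv)
  qed
  show "(f has_derivative (\<lambda>w. (\<chi> j. partial_deriv j f y) \<bullet> w)) (at y)" if "y \<in> \<Omega>" for y
  proof -
    have "blinfun_apply (f' y) w = (\<chi> j. partial_deriv j f y) \<bullet> w" for w
    proof -
      have "blinfun_apply (f' y) w = blinfun_apply (f' y) (\<Sum>j\<in>UNIV. w $ j *\<^sub>R axis j 1)"
        using basis_expansion[of w] by (simp add: scalar_mult_eq_scaleR)
      then show ?thesis
        by (simp add: blinfun.sum_right blinfun.scaleR_right pd[OF that] inner_vec_def mult.commute)
    qed
    then have "blinfun_apply (f' y) = (\<lambda>w. (\<chi> j. partial_deriv j f y) \<bullet> w)" by (rule ext)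
    then show ?thesis using f'(1)[OF that] by simp
  qed
  have "continuous_on \<Omega> (\<lambda>y. \<chi> j. blinfun_apply (f' y) (axis j 1))"
    using f'(2) by (intro continuous_intros)
  then show "continuous_on \<Omega> (\<lambda>y. \<chi> j. partial_deriv j f y)"
    by (rule continuous_on_eq) (simp add: pd)
qed

definition join :: "(real ^ 'k::finite) \<times> (real ^ 'm::finite) \<Rightarrow> real ^ ('k + 'm)" where
  "join x = (\<chi> i. case i of Inl a \<Rightarrow> fst x $ a | Inr b \<Rightarrow> snd x $ b)"

lemma dist_join: "dist (join x) (join y) = dist x y"
proof -
  have sum: "(\<Sum>i\<in>UNIV. F i) = (\<Sum>a\<in>UNIV. F (Inl a)) + (\<Sum>b\<in>UNIV. F (Inr b))" for F :: "'a + 'b \<Rightarrow> real"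
    by (subst UNIV_Plus_UNIV[symmetric], subst sum.Plus) auto
  have "(dist (join x) (join y))\<^sup>2 = (dist x y)\<^sup>2"
    by (cases x; cases y) (simp add: dist_Pair_power2 dist_norm power2_norm_eq_inner inner_vec_def join_def sum)
  then show ?thesis by simp
qed

lemma spherical_array_eq_join:
  assumes "U \<subseteq> \<Omega>" "\<And>y. y \<in> \<Omega> \<Longrightarrow> 0 \<le> f y"
  shows "{x \<in> spherical_array \<Omega> f. base_point x \<in> U} =
    (join ` {(v, y). y \<in> U \<and> norm v = f y} :: (real ^ ('k::finite + 'm::finite)) set)"
proof -
  have norm_iff: "(\<Sum>i\<in>UNIV. (v $ i)\<^sup>2) = (f y)\<^sup>2 \<longleftrightarrow> norm v = f y" if "y \<in> U" for v :: "real ^ 'k" and y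
  proof -
    have "(\<Sum>i\<in>UNIV. (v $ i)\<^sup>2) = (norm v)\<^sup>2"
      unfolding power2_norm_eq_inner inner_vec_def by (simp add: power2_eq_square)
    then show ?thesis using assms that by (metis norm_ge_zero power2_eq_iff_nonneg subsetD)
  qed
  show ?thesis
  proof (intro set_eqI iffI)
    fix x :: "real ^ ('k + 'm)" assume x: "x \<in> {x \<in> spherical_array \<Omega> f. base_point x \<in> U}"
    have "x = join (\<chi> a. x $ Inl a, base_point x)"
      by (auto simp: vec_eq_iff join_def base_point_def split: sum.split)
    moreover have "norm (\<chi> a. x $ Inl a) = f (base_point x)"
      using x norm_iff[of "base_point x" "\<chi> a. x $ Inl a"] by (simp add: spherical_array_def)
    ultimately show "x \<in> join ` {(v, y). y \<in> U \<and> norm v = f y}" using x by blast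
  next
    fix x :: "real ^ ('k + 'm)" assume "x \<in> join ` {(v, y). y \<in> U \<and> norm v = f y}"
    then obtain v y where vy: "y \<in> U" "norm v = f y" "x = join (v, y)" by blast
    have "base_point x = y" "\<And>i. x $ Inl i = v $ i" by (simp_all add: vy(3) join_def base_point_def)
    then show "x \<in> {x \<in> spherical_array \<Omega> f. base_point x \<in> U}"
      using vy(1,2) norm_iff[of y v] assms(1) by (auto simp: spherical_array_def)
  qed
qed

theorem lemma3p3:
  fixes n k :: nat
    and \<Omega> U :: "(real ^ 'm::finite) set"
    and f :: "real ^ 'm \<Rightarrow> real"
    and H :: "(real ^ ('k::finite + 'm)) set"
  assumes "2 \<le> k" and "k \<le> n - 1"
    and "CARD('k) = k" and "CARD('m) = n - k"
    and "open \<Omega>" and "connected \<Omega>" and "\<Omega> \<noteq> {}"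
    and "\<And>y. y \<in> \<Omega> \<Longrightarrow> 0 \<le> f y"
    and "C1_on \<Omega> f"
    and "H = spherical_array \<Omega> f"
    and "U \<in> sets lebesgue" and "U \<subseteq> \<Omega>"
  shows "hausdorff_measure (n - 1) {x \<in> H. base_point x \<in> U} =
    (\<integral>\<^sup>+ y \<in> U. hausdorff_measure (k - 1) (sphere (0 :: real ^ 'k) 1) *
       ennreal (f y ^ (k - 1) * sqrt (1 + (\<Sum>j\<in>UNIV. (partial_deriv j f y)\<^sup>2))) \<partial>lebesgue)"
proof -
  have "CARD('k) \<noteq> 1" using assms(1,3) by simp
  then interpret stereographic
    "\<lambda>t :: real ^ 'k equator. (\<chi> i. if i = undefined then 0 else t $ Abs_equator i) :: real ^ 'k"
    "axis undefined 1"
    by (rule stereographic_equator)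
  have dim: "CARD('k equator) = k - 1" "DIM(real ^ 'k equator) + CARD('m) = n - 1"
    using CARD_equator[OF \<open>CARD('k) \<noteq> 1\<close>] assms(1-4) by simp_all
  have grad: "(norm (\<chi> j. partial_deriv j f y))\<^sup>2 = (\<Sum>j\<in>UNIV. (partial_deriv j f y)\<^sup>2)" for y
    unfolding power2_norm_eq_inner inner_vec_def by (simp add: power2_eq_square)
  have "{x \<in> H. base_point x \<in> U} = join ` {(v, y). y \<in> U \<and> norm v = f y}"
    unfolding assms(10) by (rule spherical_array_eq_join[OF assms(12,8)])
  then have "hausdorff_measure (n - 1) {x \<in> H. base_point x \<in> U} =
      hausdorff_measure (n - 1) {(v :: real ^ 'k, y). y \<in> U \<and> norm v = f y}"
    by (simp add: hausdorff_measure_isometry_image dist_join)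
  then show ?thesis
    using hausdorff_measure_warped_product[OF assms(5,8) gradient_of_C1_on[OF assms(9)] assms(11,12)]
    unfolding dim grad by (simp add: dim)
qed

end
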